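(* Let $N\ge 1$, let $\Lambda$ be a random matrix distributed according to the Haar probability measure on the group $U(N)$ of $N\times N$ unitary matrices, and let $Z_N(\Lambda)=\det(I-\Lambda)$. Then: (1) For every complex $t$ with $\Re(t)>-1$, $$\mathbb{E}\left[|Z_N(\Lambda)|^{t}\right]=\prod_{j=1}^{N}\frac{\Gamma(j)\,\Gamma(j+t)}{\left(\Gamma\left(j+\frac t2\right)\right)^{2}}.$$ (2) Equivalently, in probabilistic terms, one has the identity in law $$\prod_{j=1}^{N}\gamma_j\ \stackrel{\text{law}}{=}\ |Z_N(\Lambda)|\prod_{j=1}^{N}\sqrt{\gamma_j\gamma_j'},$$ where on each side all the variables are independent (on the left, $\gamma_1,\dots,\gamma_N$; on the right, $\Lambda,\gamma_1,\dots,\gamma_N,\gamma_1',\dots,\gamma_N'$), and $\gamma_j,\gamma_j'$ are gamma random variables with parameter $j$.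
   Context: A gamma variable $\gamma_a$ with parameter $a>0$ has law $\mathbb{P}(\gamma_a\in dt)=\frac{t^{a-1}e^{-t}}{\Gamma(a)}\,dt$ on $t>0$. *)

theory Defs
  imports "HOL-Probability.Probability"
begin

definition conj_transpose :: "complex ^ 'n ^ 'm \<Rightarrow> complex ^ 'm ^ 'n" where
  "conj_transpose A = (\<chi> i j. cnj (A $ j $ i))"

definition unitary_group :: "(complex ^ 'n ^ 'n) set" where
  "unitary_group = {A. conj_transpose A ** A = mat 1 \<and> A ** conj_transpose A = mat 1}"

abbreviation unitary_borel :: "(complex ^ 'n ^ 'n) measure" where
  "unitary_borel \<equiv> restrict_space borel unitary_group"

text \<open>
  The Haar probability measure is characterised by left invariance.
  Since the group is compact and metrisable, exactly one such measure exists,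
  and it is automatically regular and right-invariant.
\<close>

definition haar_probability :: "(complex ^ 'n ^ 'n) measure \<Rightarrow> bool" where
  "haar_probability \<mu> \<longleftrightarrow>
     prob_space \<mu> \<and> sets \<mu> = sets unitary_borel \<and>
     (\<forall>U\<in>unitary_group. distr \<mu> \<mu> (\<lambda>A. U ** A) = \<mu>)"

definition haar_distributed :: "'a measure \<Rightarrow> ('a \<Rightarrow> complex ^ 'n ^ 'n) \<Rightarrow> bool" where
  "haar_distributed M \<Lambda> \<longleftrightarrow>
     \<Lambda> \<in> measurable M unitary_borel \<and> haar_probability (distr M unitary_borel \<Lambda>)"

definition Z :: "complex ^ 'n ^ 'n \<Rightarrow> complex" where
  "Z A = det (mat 1 - A)"

definition gamma_density :: "real \<Rightarrow> real \<Rightarrow> real" where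
  "gamma_density a t = (if t > 0 then t powr (a - 1) * exp (- t) / Gamma a else 0)"

definition gamma_variable :: "'a measure \<Rightarrow> real \<Rightarrow> ('a \<Rightarrow> real) \<Rightarrow> bool" where
  "gamma_variable M a X \<longleftrightarrow> distributed M lborel X (\<lambda>t. ennreal (gamma_density a t))"

text \<open>
  The constant \<^const>\<open>prob_space.indep_vars\<close> requires all variables to share a value type.
  Independence of a random matrix together with two families of real variables is
  therefore stated as joint independence of the generated sigma-algebras,
  indexed by the following type.
\<close>

datatype rv_index = Mat | Gam nat | Gam' nat

definition jointly_independent ::
  "'a measure \<Rightarrow> ('a \<Rightarrow> complex ^ 'n ^ 'n) \<Rightarrow> (nat \<Rightarrow> 'a \<Rightarrow> real) \<Rightarrow> (nat \<Rightarrow> 'a \<Rightarrow> real) \<Rightarrow> nat set \<Rightarrow> bool"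
where
  "jointly_independent M \<Lambda> \<gamma> \<gamma>' J \<longleftrightarrow>
     prob_space.indep_sets M
       (\<lambda>i. case i of
              Mat \<Rightarrow> sets (vimage_algebra (space M) \<Lambda> unitary_borel)
            | Gam j \<Rightarrow> sets (vimage_algebra (space M) (\<gamma> j) borel)
            | Gam' j \<Rightarrow> sets (vimage_algebra (space M) (\<gamma>' j) borel))
       ({Mat} \<union> Gam ` J \<union> Gam' ` J)"

end

theory Submission
  imports Defs
begin

text \<open>
  Let \<open>\<Lambda>\<close> be Haar distributed, \<open>v = \<Lambda> e\<^sub>s\<close> one of its columns and \<open>R\<close> the unitary rank-one perturbation
  of the identity with \<open>R e\<^sub>s = v\<close>. Then \<open>H = R\<^sup>-\<^sup>1 \<Lambda>\<close> fixes \<open>e\<^sub>s\<close>; it is the identity plus the Schur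
  complement of the \<open>s\<close> entry of \<open>\<Lambda> - 1\<close>, so \<open>det (1 - \<Lambda>) = (1 - v\<^sub>s) det (1 - H)\<close>, the last
  determinant being one dimension smaller. Since \<open>U \<Lambda>\<close> has the same \<open>v\<^sub>s\<close> and Schur complement \<open>U H\<close>
  whenever \<open>U\<close> fixes \<open>e\<^sub>s\<close>, the matrix \<open>H\<close> is left invariant conditionally on \<open>v\<^sub>s\<close>, and the moments of
  \<open>det (1 - \<Lambda>)\<close> factorise by induction on the dimension \<open>n\<close>.

  Invariance under plane rotations and phases gives \<open>E |v\<^sub>s|^(2 k) = k! / (n (n + 1) \<dots> (n + k - 1))\<close>.
  Expanding \<open>|1 - r v\<^sub>s|^t\<close> by the binomial series and letting \<open>r\<close> tend to 1 yields Gauss's sum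
  \<open>F(-t/2, -t/2; n; 1) = \<Gamma>(n) \<Gamma>(n + t) / \<Gamma>(n + t/2)\<^sup>2\<close> for \<open>E |1 - v\<^sub>s|^t\<close>.

  For the identity in law, compare the characteristic functions of the logarithms, which are the
  moments at imaginary \<open>t\<close>.
\<close>

subsection \<open>Gauss's hypergeometric sum\<close>

text \<open>For \<open>n >= 2\<close> this is the \<open>k\<close>-th moment of the Beta(1,
  \<open>n - 1\<close>) law, that of the squared modulus of one coordinate of a uniform unit vector
  in complex \<open>n\<close>-space; for \<open>n = 1\<close> it is constantly 1.\<close>

definition beta_moment :: "nat \<Rightarrow> nat \<Rightarrow> real" where
  "beta_moment n k = fact k / pochhammer (real n) k"

lemma beta_moment_0 [simp]: "beta_moment n 0 = 1"
  by (simp add: beta_moment_def)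

lemma beta_moment_Suc:
  "n \<ge> 1 \<Longrightarrow> beta_moment n (Suc k) = beta_moment n k * (real (Suc k) / (real n + real k))"
  by (simp add: beta_moment_def pochhammer_Suc)

lemma beta_moment_pos: "n \<ge> 1 \<Longrightarrow> beta_moment n k > 0"
  by (simp add: beta_moment_def pochhammer_pos)

text \<open>The moments do not increase with the order, so the first one bounds the later ones. The
  factor \<open>1 / n\<close> makes the tail of the hypergeometric sum vanish as \<open>n\<close>
  grows.\<close>

lemma beta_moment_Suc_le:
  assumes "n \<ge> 1"
  shows "beta_moment n (Suc k) \<le> 1 / real n"
proof (induction k)
  case 0
  then show ?case using assms by (simp add: beta_moment_Suc)
next
  case (Suc k)
  have "beta_moment n (Suc (Suc k)) = beta_moment n (Suc k) * (real (Suc (Suc k)) / (real n + real (Suc k)))"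
    using assms by (rule beta_moment_Suc)
  also have "\<dots> \<le> beta_moment n (Suc k) * 1"
    using assms less_imp_le[OF beta_moment_pos[OF assms, of "Suc k"]] by (intro mult_left_mono) auto
  finally show ?case using Suc.IH by simp
qed

lemma beta_moment_le_1: "n \<ge> 1 \<Longrightarrow> beta_moment n k \<le> 1"
  by (cases k) (auto intro!: order_trans[OF beta_moment_Suc_le])

text \<open>A rising factorial can be split at its first or at its last factor. This compares
  \<open>n\<close> with \<open>n + 1\<close> and feeds the contiguous relation for Gauss's
  sum.\<close>

lemma beta_moment_Suc_left:
  assumes "n \<ge> 1"
  shows "beta_moment (Suc n) k * (real n + real k) = beta_moment n k * real n"
proof -
  have "real n * pochhammer (real n + 1) k = (real n + real k) * pochhammer (real n) k"
    by (metis pochhammer_rec pochhammer_Suc mult.commute)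
  moreover have "pochhammer (real n) k > 0" "pochhammer (real n + 1) k > 0"
    using assms by (auto intro!: pochhammer_pos)
  ultimately show ?thesis
    by (simp add: beta_moment_def divide_simps add.commute)
qed

text \<open>By the asymptotics of binomial coefficients, \<open>a gchoose k\<close> divided by
  \<open>(-1)^k * k^(-a-1)\<close> converges, hence is bounded. The exponential in the proof is
  \<open>k^(a+1)\<close>.\<close>

lemma gbinomial_norm_bound:
  fixes a :: complex
  shows "\<exists>C. \<forall>k\<ge>1. (cmod (a gchoose k))\<^sup>2 \<le> C * real k powr (- 2 * Re a - 2)"
proof -
  let ?f = "\<lambda>k. (a gchoose k) / ((-1) ^ k / exp ((a + 1) * of_real (ln (real k))))"
  have "Bseq ?f"
    using gbinomial_asymptotic[of a] by (intro convergent_imp_Bseq convergentI)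
  then obtain K where K: "\<And>k. cmod (?f k) \<le> K"
    by (auto simp: Bseq_def)
  have "(cmod (a gchoose k))\<^sup>2 \<le> K\<^sup>2 * real k powr (- 2 * Re a - 2)" if "k \<ge> 1" for k
  proof -
    have norm_f: "cmod (?f k) = cmod (a gchoose k) * real k powr (Re a + 1)"
      using that by (simp add: norm_mult norm_divide norm_power powr_def)
    have sq: "(real k powr (Re a + 1))\<^sup>2 = real k powr (2 * Re a + 2)"
      by (simp add: power2_eq_square powr_add[symmetric])
    from K[of k] norm_f have "cmod (a gchoose k) * real k powr (Re a + 1) \<le> K" by simp
    then have "(cmod (a gchoose k) * real k powr (Re a + 1))\<^sup>2 \<le> K\<^sup>2"
      by (intro power_mono) auto
    then have "(cmod (a gchoose k))\<^sup>2 * real k powr (2 * Re a + 2) \<le> K\<^sup>2"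
      by (simp only: power_mult_distrib sq)
    moreover have "real k powr (2 * Re a + 2) * real k powr (- 2 * Re a - 2) = 1"
      using that by (simp add: powr_add[symmetric])
    moreover have "real k powr (- 2 * Re a - 2) \<ge> 0" by simp
    ultimately show ?thesis
      using mult_right_mono[of "(cmod (a gchoose k))\<^sup>2 * real k powr (2 * Re a + 2)" "K\<^sup>2"
        "real k powr (- 2 * Re a - 2)"]
      by (simp add: mult.assoc)
  qed
  then show ?thesis by blast
qed

text \<open>The exponent \<open>- 2 * Re a - 2\<close> is below -1 exactly under the hypothesis; for
  \<open>a = t / 2\<close> this is the condition \<open>Re t > - 1\<close> of the theorem.\<close>

lemma gbinomial_square_summable:
  fixes a :: complex
  assumes "Re a > - 1 / 2"
  shows "summable (\<lambda>k. (cmod (a gchoose k))\<^sup>2)"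
proof -
  obtain C where C: "\<And>k. k \<ge> 1 \<Longrightarrow> (cmod (a gchoose k))\<^sup>2 \<le> C * real k powr (- 2 * Re a - 2)"
    using gbinomial_norm_bound[of a] by blast
  have "summable (\<lambda>k. C * real k powr (- 2 * Re a - 2))"
    using assms by (intro summable_mult) (simp add: summable_real_powr_iff)
  then show ?thesis
    by (rule summable_comparison_test_ev[rotated])
      (use C in \<open>auto intro!: eventually_sequentiallyI[of 1]\<close>)
qed

text \<open>Supplies the vanishing boundary term at infinity when the contiguous relation is
  telescoped.\<close>

lemma gbinomial_square_times_index_tendsto:
  fixes a :: complex
  assumes "Re a > - 1 / 2"
  shows "(\<lambda>k. real k * (cmod (a gchoose k))\<^sup>2) \<longlonglongrightarrow> 0"
proof -
  obtain C where C: "\<And>k. k \<ge> 1 \<Longrightarrow> (cmod (a gchoose k))\<^sup>2 \<le> C * real k powr (- 2 * Re a - 2)"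
    using gbinomial_norm_bound[of a] by blast
  have "((\<lambda>x::real. x powr (- 2 * Re a - 1)) \<longlongrightarrow> 0) at_top"
    using assms by (intro tendsto_neg_powr filterlim_ident) auto
  then have "(\<lambda>k. C * real k powr (- 2 * Re a - 1)) \<longlonglongrightarrow> C * 0"
    by (intro tendsto_mult tendsto_const) (rule filterlim_compose[OF _ filterlim_real_sequentially])
  then have lim: "(\<lambda>k. C * real k powr (- 2 * Re a - 1)) \<longlonglongrightarrow> 0" by simp
  show ?thesis
  proof (rule tendsto_sandwich[OF _ _ tendsto_const lim])
    show "\<forall>\<^sub>F k in sequentially. real k * (cmod (a gchoose k))\<^sup>2 \<le> C * real k powr (- 2 * Re a - 1)"
    proof (intro eventually_sequentiallyI[of 1])
      fix k :: nat assume k: "1 \<le> k"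
      have "real k * (cmod (a gchoose k))\<^sup>2 \<le> real k powr 1 * (C * real k powr (- 2 * Re a - 2))"
        using C[OF k] k by (auto intro!: mult_left_mono)
      also have "\<dots> = C * (real k powr 1 * real k powr (- 2 * Re a - 2))" by (simp only: mult_ac)
      also have "\<dots> = C * real k powr (- 2 * Re a - 1)"
      proof -
        have "1 + (- 2 * Re a - 2) = - 2 * Re a - 1" by simp
        then show ?thesis by (simp only: powr_add[symmetric])
      qed
      finally show "real k * (cmod (a gchoose k))\<^sup>2 \<le> C * real k powr (- 2 * Re a - 1)" .
    qed
  qed auto
qed

lemma Re_gt_imp_not_nonpos_Ints: "Re z > 0 \<Longrightarrow> z \<notin> \<int>\<^sub>\<le>\<^sub>0"
  by (auto elim!: nonpos_Ints_cases)

text \<open>Each \<open>Gamma\<close> is expressed through its limit formula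
  \<open>rGamma_series\<close>. The powers of \<open>n\<close> cancel since
  \<open>1 + (1 + 2 * a) = 2 * (1 + a)\<close>, the factorials cancel too, and the remaining
  constants multiply to 1 in the limit.\<close>

lemma Gamma_ratio_tendsto:
  fixes a :: complex
  assumes a: "Re a > - 1 / 2"
  shows "(\<lambda>n. Gamma (of_nat n) * Gamma (of_nat n + 2 * a) / (Gamma (of_nat n + a))\<^sup>2) \<longlonglongrightarrow> 1"
proof -
  define D :: "nat \<Rightarrow> complex"
    where "D n = Gamma (of_nat n) * Gamma (of_nat n + 2 * a) / (Gamma (of_nat n + a))\<^sup>2" for n
  have ni: "(1::complex) \<notin> \<int>\<^sub>\<le>\<^sub>0" "1 + a \<notin> \<int>\<^sub>\<le>\<^sub>0" "1 + 2 * a \<notin> \<int>\<^sub>\<le>\<^sub>0"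
    using a by (auto intro!: Re_gt_imp_not_nonpos_Ints)
  have G: "Gamma (z + of_nat (n + 1)) = pochhammer z (n + 1) * Gamma z" if "z \<notin> \<int>\<^sub>\<le>\<^sub>0" for z :: complex and n
    using that by (subst pochhammer_Gamma) (auto simp: Gamma_eq_zero_iff)
  let ?R = "\<lambda>n. rGamma_series 1 n * rGamma_series (1 + 2 * a) n / (rGamma_series (1 + a) n)\<^sup>2
     * (Gamma 1 * Gamma (1 + 2 * a) / (Gamma (1 + a))\<^sup>2)"
  \<comment> \<open>The Pochhammer symbol in \<open>rGamma_series z n\<close> has
    \<open>n + 1\<close> factors and the arguments start at 1, so the ratio appears at index
    \<open>n + 2\<close>.\<close>
  have eq: "?R n = D (n + 2)" for n
  proof -
    have e: "exp (1 * of_real (ln (real n))) * exp ((1 + 2 * a) * of_real (ln (real n)))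
        = (exp ((1 + a) * of_real (ln (real n))))\<^sup>2"
      by (simp add: exp_add[symmetric] power2_eq_square algebra_simps)
    define E1 E2 E3 P1 P2 P3 where
      "E1 = exp (1 * complex_of_real (ln (real n)))" "E2 = exp ((1 + 2 * a) * of_real (ln (real n)))"
      "E3 = exp ((1 + a) * of_real (ln (real n)))" "P1 = pochhammer (1::complex) (n + 1)"
      "P2 = pochhammer (1 + 2 * a) (n + 1)" "P3 = pochhammer (1 + a) (n + 1)"
    note defs = this
    have "?R n = (P1 / (fact n * E1)) * (P2 / (fact n * E2)) / (P3 / (fact n * E3))\<^sup>2
        * (Gamma 1 * Gamma (1 + 2 * a) / (Gamma (1 + a))\<^sup>2)"
      by (simp add: rGamma_series_def defs exp_of_real)
    also have "\<dots> = (P1 * P2 / P3\<^sup>2) * (E3\<^sup>2 / (E1 * E2)) * (Gamma 1 * Gamma (1 + 2 * a) / (Gamma (1 + a))\<^sup>2)"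
      by (simp add: power_divide power_mult_distrib power2_eq_square divide_simps)
    also have "E3\<^sup>2 / (E1 * E2) = 1" using e by (simp add: defs)
    also have "(P1 * P2 / P3\<^sup>2) * 1 * (Gamma 1 * Gamma (1 + 2 * a) / (Gamma (1 + a))\<^sup>2)
      = (P1 * Gamma 1) * (P2 * Gamma (1 + 2 * a)) / (P3 * Gamma (1 + a))\<^sup>2"
      by (simp add: power_mult_distrib)
    also have "\<dots> = Gamma (1 + of_nat (n + 1)) * Gamma (1 + 2 * a + of_nat (n + 1)) / (Gamma (1 + a + of_nat (n + 1)))\<^sup>2"
      unfolding defs by (simp only: G[OF ni(1)] G[OF ni(2)] G[OF ni(3)])
    also have "\<dots> = D (n + 2)" by (simp add: D_def algebra_simps)
    finally show ?thesis .
  qed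
  have "?R \<longlonglongrightarrow> rGamma 1 * rGamma (1 + 2 * a) / (rGamma (1 + a))\<^sup>2
     * (Gamma 1 * Gamma (1 + 2 * a) / (Gamma (1 + a))\<^sup>2)"
    using ni by (intro tendsto_intros) (auto simp: rGamma_eq_zero_iff)
  also have "rGamma 1 * rGamma (1 + 2 * a) / (rGamma (1 + a))\<^sup>2
     * (Gamma 1 * Gamma (1 + 2 * a) / (Gamma (1 + a))\<^sup>2) = (1::complex)"
    using ni by (simp add: rGamma_inverse_Gamma Gamma_eq_zero_iff field_simps)
  finally have "(\<lambda>n. D (n + 2)) \<longlonglongrightarrow> 1" by (simp only: eq)
  then have "D \<longlonglongrightarrow> 1" by (rule LIMSEQ_offset)
  then show ?thesis unfolding D_def[abs_def] .
qed

text \<open>Gauss's evaluation of \<open>F(-a, -a; n; 1)\<close>: a contiguous relation, proved by telescoping,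
  shows that the quotient of both sides does not depend on \<open>n\<close>; it tends to 1 as \<open>n\<close> grows.\<close>

theorem gauss_sum:
  fixes a :: complex
  assumes n: "n \<ge> 1" and a: "Re a > - 1 / 2"
  shows "(\<lambda>k. of_real (beta_moment n k) * (a gchoose k)\<^sup>2) sums
    (Gamma (of_nat n) * Gamma (of_nat n + 2 * a) / (Gamma (of_nat n + a))\<^sup>2)"
proof -
  define B where "B k = (cmod (a gchoose k))\<^sup>2" for k
  define T where "T n k = complex_of_real (beta_moment n k) * (a gchoose k)\<^sup>2" for n k
  define S where "S n = (\<Sum>k. T n k)" for n
  define D :: "nat \<Rightarrow> complex"
    where "D n = Gamma (of_nat n) * Gamma (of_nat n + 2 * a) / (Gamma (of_nat n + a))\<^sup>2" for n
  have sumB: "summable B" using gbinomial_square_summable[OF a] by (simp add: B_def[abs_def])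
  have norm_T: "cmod (T n k) = beta_moment n k * B k" if "n \<ge> 1" for n k
    using beta_moment_pos[OF that, of k] by (simp add: T_def B_def norm_mult norm_power)
  have T_le: "cmod (T n k) \<le> B k" if "n \<ge> 1" for n k
    unfolding norm_T[OF that] using beta_moment_le_1[OF that, of k] beta_moment_pos[OF that, of k]
    by (intro mult_left_le_one_le) (auto simp: B_def)
  have sumT: "summable (\<lambda>k. cmod (T n k))" if "n \<ge> 1" for n
    by (rule summable_comparison_test'[OF sumB]) (use T_le[OF that] in auto)
  have T_sums: "T n sums S n" if "n \<ge> 1" for n
    unfolding S_def using sumT[OF that] by (intro summable_sums) (rule summable_norm_cancel)
  have T_Suc: "T n (Suc k) * (of_nat (Suc k) * (of_nat n + of_nat k)) = T n k * (a - of_nat k)\<^sup>2"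
    if "n \<ge> 1" for n k
  proof -
    have "(a gchoose Suc k) * of_nat (Suc k) = (a gchoose k) * (a - of_nat k)"
      using gbinomial_mult_1[of a k] by (simp add: algebra_simps)
    then have "((a gchoose Suc k) * of_nat (Suc k))\<^sup>2 = (a gchoose k)\<^sup>2 * (a - of_nat k)\<^sup>2"
      by (simp add: power_mult_distrib)
    moreover have "complex_of_real (beta_moment n (Suc k)) * (of_nat n + of_nat k)
        = of_real (beta_moment n k) * of_nat (Suc k)"
    proof -
      have "beta_moment n (Suc k) * (real n + real k) = beta_moment n k * real (Suc k)"
        using that by (simp add: beta_moment_Suc)
      from arg_cong[OF this, of complex_of_real] show ?thesis by simp
    qed
    moreover have "of_nat (Suc k) \<noteq> (0::complex)" by (simp del: of_nat_Suc)
    ultimately show ?thesis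
      unfolding T_def power2_eq_square by (simp del: of_nat_Suc) algebra
  qed
  have T_left: "T (Suc n) k * (of_nat n + of_nat k) = T n k * of_nat n" if "n \<ge> 1" for n k
    using arg_cong[OF beta_moment_Suc_left[OF that, of k], of complex_of_real]
    unfolding T_def by (simp add: algebra_simps) (metis distrib_left mult.commute mult.left_commute)
  \<comment> \<open>A telescoping certificate: the combination of the summands for \<open>n\<close>
    and \<open>n + 1\<close> is the difference of \<open>- n * k * T n k\<close>. After
    multiplication by \<open>n + k\<close>, the relations \<open>T_Suc\<close> and
    \<open>T_left\<close> reduce everything to \<open>T n k\<close>.\<close>
  have contiguous: "of_nat n * (of_nat n + 2 * a) * T n k - (of_nat n + a)\<^sup>2 * T (Suc n) k
     = - of_nat n * (of_nat (Suc k) * T n (Suc k) - of_nat k * T n k)" if "n \<ge> 1" for n k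
  proof -
    have nz: "(of_nat n + of_nat k :: complex) \<noteq> 0"
      using that by (metis of_nat_add of_nat_eq_0_iff add_is_0 not_one_le_zero)
    have "(of_nat n + of_nat k) * (of_nat n * (of_nat n + 2 * a) * T n k - (of_nat n + a)\<^sup>2 * T (Suc n) k)
      = (of_nat n + of_nat k) * (- of_nat n * (of_nat (Suc k) * T n (Suc k) - of_nat k * T n k))"
      using T_Suc[OF that, of k] T_left[OF that, of k] unfolding power2_eq_square by algebra
    with nz show ?thesis by (metis mult_left_cancel)
  qed
  have lim0: "(\<lambda>k. of_nat k * T n k) \<longlonglongrightarrow> 0" if "n \<ge> 1" for n
  proof (rule Lim_null_comparison[OF _ gbinomial_square_times_index_tendsto[OF a]])
    show "\<forall>\<^sub>F k in sequentially. cmod (of_nat k * T n k) \<le> real k * (cmod (a gchoose k))\<^sup>2"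
      using T_le[OF that] by (auto simp: B_def norm_mult intro!: always_eventually mult_left_mono)
  qed
  have recS: "of_nat n * (of_nat n + 2 * a) * S n = (of_nat n + a)\<^sup>2 * S (Suc n)" if "n \<ge> 1" for n
  proof -
    have "(\<lambda>k. - of_nat n * (of_nat (Suc k) * T n (Suc k) - of_nat k * T n k)) sums (- of_nat n * (0 - of_nat 0 * T n 0))"
      by (intro sums_mult telescope_sums[OF lim0[OF that]])
    moreover have "(\<lambda>k. of_nat n * (of_nat n + 2 * a) * T n k - (of_nat n + a)\<^sup>2 * T (Suc n) k) sums
       (of_nat n * (of_nat n + 2 * a) * S n - (of_nat n + a)\<^sup>2 * S (Suc n))"
      using that by (intro sums_diff sums_mult T_sums) auto
    ultimately have "of_nat n * (of_nat n + 2 * a) * S n - (of_nat n + a)\<^sup>2 * S (Suc n) = 0"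
      unfolding contiguous[OF that] using sums_unique2 by fastforce
    then show ?thesis by simp
  qed
  have ni: "(of_nat n :: complex) \<notin> \<int>\<^sub>\<le>\<^sub>0" "of_nat n + a \<notin> \<int>\<^sub>\<le>\<^sub>0" "of_nat n + 2 * a \<notin> \<int>\<^sub>\<le>\<^sub>0"
    if "n \<ge> 1" for n
    using a that by (auto intro!: Re_gt_imp_not_nonpos_Ints)
  have D_nz: "D n \<noteq> 0" if "n \<ge> 1" for n
    using ni[OF that] by (auto simp: D_def Gamma_eq_zero_iff)
  have na: "of_nat n + a \<noteq> 0" if "n \<ge> 1" for n using ni(2)[OF that] by auto
  \<comment> \<open>The closed form obeys the same first-order recursion as \<open>S\<close>, by
    \<open>Gamma (z + 1) = z * Gamma z\<close>.\<close>
  have recD: "of_nat n * (of_nat n + 2 * a) * D n = (of_nat n + a)\<^sup>2 * D (Suc n)" if "n \<ge> 1" for n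
  proof -
    have "D (Suc n) = (of_nat n * Gamma (of_nat n)) * ((of_nat n + 2 * a) * Gamma (of_nat n + 2 * a))
       / ((of_nat n + a) * Gamma (of_nat n + a))\<^sup>2"
      unfolding D_def using Gamma_plus1[OF ni(1)[OF that]] Gamma_plus1[OF ni(2)[OF that]]
        Gamma_plus1[OF ni(3)[OF that]]
      by (simp add: add_ac)
    then show ?thesis
      using na[OF that] by (simp add: D_def power_mult_distrib)
  qed
  have q: "S (Suc m) / D (Suc m) = S 1 / D 1" for m
  proof (induction m)
    case (Suc m)
    have "(of_nat (Suc m) + a)\<^sup>2 \<noteq> 0" using na[of "Suc m"] by simp
    moreover have "S (Suc (Suc m)) * D (Suc m) * (of_nat (Suc m) + a)\<^sup>2
       = S (Suc m) * D (Suc (Suc m)) * (of_nat (Suc m) + a)\<^sup>2"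
      using recS[of "Suc m", simplified] recD[of "Suc m", simplified] by (simp) algebra
    ultimately have "S (Suc (Suc m)) / D (Suc (Suc m)) = S (Suc m) / D (Suc m)"
      using D_nz[of "Suc m"] D_nz[of "Suc (Suc m)"] by (simp add: frac_eq_eq)
    then show ?case using Suc.IH by simp
  qed simp
  have S_lim: "(\<lambda>m. S (Suc m)) \<longlonglongrightarrow> 1"
  proof -
    \<comment> \<open>Only the term at \<open>k = 0\<close> survives for large \<open>n\<close>: the
      others carry a beta moment of at most \<open>1 / n\<close>, and the squared binomials are
      summable.\<close>
    have bound: "cmod (S n - 1) \<le> (\<Sum>k. B (Suc k)) * (1 / real n)" if "n \<ge> 1" for n
    proof -
      have sB: "summable (\<lambda>k. B (Suc k))" using sumB by (simp add: summable_Suc_iff)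
      have "(\<lambda>k. T n (Suc k)) sums (S n - T n 0)"
        using T_sums[OF that] by (simp add: sums_Suc_iff)
      then have "S n - 1 = (\<Sum>k. T n (Suc k))"
        by (simp add: sums_iff T_def)
      also have "cmod \<dots> \<le> (\<Sum>k. cmod (T n (Suc k)))"
        using summable_ignore_initial_segment[OF sumT[OF that], of 1] by (intro summable_norm) simp
      also have "\<dots> \<le> (\<Sum>k. B (Suc k) * (1 / real n))"
      proof (rule suminf_le)
        show "cmod (T n (Suc k)) \<le> B (Suc k) * (1 / real n)" for k
          unfolding norm_T[OF that]
          using beta_moment_Suc_le[OF that, of k] mult_right_mono[of "beta_moment n (Suc k)" "1 / real n" "B (Suc k)"]
          by (simp add: B_def mult.commute)
        show "summable (\<lambda>k. cmod (T n (Suc k)))" using summable_ignore_initial_segment[OF sumT[OF that], of 1] by simp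
        show "summable (\<lambda>k. B (Suc k) * (1 / real n))" using sB by (rule summable_mult2)
      qed
      also have "\<dots> = (\<Sum>k. B (Suc k)) * (1 / real n)"
        using sB by (rule suminf_mult2[symmetric])
      finally show ?thesis .
    qed
    have "(\<lambda>m. (\<Sum>k. B (Suc k)) * (1 / real (Suc m))) \<longlonglongrightarrow> (\<Sum>k. B (Suc k)) * 0"
      by (intro tendsto_mult tendsto_const) (use LIMSEQ_inverse_real_of_nat in \<open>simp add: inverse_eq_divide\<close>)
    then have "(\<lambda>m. (\<Sum>k. B (Suc k)) * (1 / real (Suc m))) \<longlonglongrightarrow> 0" by simp
    then have "(\<lambda>m. S (Suc m) - 1) \<longlonglongrightarrow> 0"
      by (rule Lim_null_comparison[rotated]) (intro always_eventually allI bound, simp)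
    then show ?thesis by (simp add: LIM_zero_iff)
  qed
  have "(\<lambda>m. D (Suc m)) \<longlonglongrightarrow> 1"
    using Gamma_ratio_tendsto[OF a] unfolding D_def by (rule LIMSEQ_Suc)
  with S_lim have "(\<lambda>m. S (Suc m) / D (Suc m)) \<longlonglongrightarrow> 1 / 1"
    by (intro tendsto_divide) auto
  then have "S 1 / D 1 = 1"
    unfolding q by (simp add: LIMSEQ_const_iff)
  with q[of "n - 1"] n have "S n = D n" using D_nz[OF n] by simp
  with T_sums[OF n] show ?thesis by (simp add: T_def[abs_def] D_def)
qed

subsection \<open>Moments of the distance to 1 on the unit disc\<close>

lemma borel_measurable_cnj [measurable]:
  assumes "f \<in> borel_measurable M"
  shows "(\<lambda>x. cnj (f x)) \<in> borel_measurable M"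
  by (rule measurable_compose[OF assms]) (intro borel_measurable_continuous_onI continuous_intros)

text \<open>In the right half-plane \<open>w\<close> and its conjugate avoid the branch cut and have
  opposite arguments, so their logarithms add up to \<open>2 * ln (cmod w)\<close>. Both factors
  carry \<open>a\<close> rather than \<open>a\<close> and its conjugate, which is why squares of
  binomials, not squared moduli, appear in the expansion.\<close>

lemma cmod_powr_eq_mult_cnj:
  fixes w a :: complex
  assumes "Re w > 0"
  shows "complex_of_real (cmod w) powr (2 * a) = w powr a * cnj w powr a"
proof -
  from assms have w: "w \<noteq> 0" "w \<notin> \<real>\<^sub>\<le>\<^sub>0" by (auto simp: complex_nonpos_Reals_iff)
  have "Ln w + Ln (cnj w) = of_real (2 * ln (cmod w))"
    using w by (simp add: cnj_Ln[symmetric] complex_add_cnj)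
  then have "a * Ln w + a * Ln (cnj w) = 2 * a * Ln (of_real (cmod w))"
    using w by (simp add: Ln_of_real distrib_left[symmetric])
  then show ?thesis
    using w by (simp add: powr_def exp_add[symmetric])
qed

lemma norm_of_real_powr: "x \<ge> 0 \<Longrightarrow> cmod (complex_of_real x powr t) = x powr Re t"
  by (auto simp: norm_powr_real_powr)

lemma borel_measurable_cmod_powr [measurable]:
  assumes [measurable]: "f \<in> borel_measurable M"
  shows "(\<lambda>x. complex_of_real (cmod (f x)) powr t) \<in> borel_measurable M"
proof -
  have "(\<lambda>x. complex_of_real (cmod (f x)) powr t)
      = (\<lambda>x. if cmod (f x) = 0 then 0 else exp (t * of_real (ln (cmod (f x)))))"
    by (auto simp: powr_def Ln_of_real fun_eq_iff)
  also have "\<dots> \<in> borel_measurable M" by measurable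
  finally show ?thesis .
qed

text \<open>Abstracts a diagonal entry of an invariant random matrix. The total mass stays free
  because the induction meets measures reweighted by densities.\<close>

locale beta_moments = finite_measure M for M :: "'a measure" +
  fixes X :: "'a \<Rightarrow> complex" and n :: nat
  assumes X_meas [measurable]: "X \<in> borel_measurable M"
    and X_le_1: "AE x in M. cmod (X x) \<le> 1"
    and X_cross: "j \<noteq> k \<Longrightarrow> (\<integral>x. X x ^ j * cnj (X x) ^ k \<partial>M) = 0"
    and X_moment: "(\<integral>x. cmod (X x) ^ (2 * k) \<partial>M) = measure M (space M) * beta_moment n k"
    and n_pos: "n \<ge> 1"
begin

text \<open>For \<open>r < 1\<close> the binomial series in \<open>X\<close> and in
  \<open>cnj X\<close> converge absolutely, with partial sums bounded by one constant, so their
  product can be integrated term by term. The mixed moments vanish and the diagonal ones are beta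
  moments.\<close>

lemma expansion_inside_disc:
  assumes r: "0 \<le> r" "r < 1"
  shows "(\<lambda>k. of_real (measure M (space M) * beta_moment n k) * (a gchoose k)\<^sup>2 * of_real (r ^ (2 * k)))
    sums (\<integral>x. complex_of_real (cmod (1 - of_real r * X x)) powr (2 * a) \<partial>M)"
proof -
  define K where "K = (\<Sum>k. cmod ((a gchoose k) * of_real r ^ k))"
  define g where "g N z = (\<Sum>k<N. (a gchoose k) * (- of_real r * z) ^ k)" for N :: nat and z :: complex
  have sumK: "summable (\<lambda>k. cmod ((a gchoose k) * of_real r ^ k))"
    by (rule abs_summable_in_conv_radius) (use r in \<open>simp add: conv_radius_gchoose\<close>)
  have g_bound: "cmod (g N z) \<le> K" if "cmod z \<le> 1" for N z
  proof -
    have "cmod (g N z) \<le> (\<Sum>k<N. cmod ((a gchoose k) * of_real r ^ k))"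
      unfolding g_def using r that
      by (intro order_trans[OF norm_sum] sum_mono)
         (auto simp: norm_mult norm_power power_mult_distrib intro!: mult_left_mono mult_right_le_one_le power_le_one)
    also have "\<dots> \<le> K" unfolding K_def by (intro sum_le_suminf sumK) auto
    finally show ?thesis .
  qed
  have K: "K \<ge> 0" unfolding K_def by (intro suminf_nonneg sumK) auto
  have rz: "cmod (- of_real r * z) < 1" if "cmod z \<le> 1" for z
    using r that by (simp add: norm_mult) (meson le_less_trans mult_left_le norm_ge_zero)
  have g_lim: "(\<lambda>N. g N z) \<longlonglongrightarrow> (1 - of_real r * z) powr a" if "cmod z \<le> 1" for z
    using gen_binomial_complex[OF rz[OF that], of a] by (simp add: sums_def g_def)
  have lim: "(\<lambda>N. g N z * g N (cnj z)) \<longlonglongrightarrow> complex_of_real (cmod (1 - of_real r * z)) powr (2 * a)"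
    if z: "cmod z \<le> 1" for z
  proof -
    have "Re (1 - of_real r * z) > 0"
      using rz[OF z] abs_Re_le_cmod[of "- of_real r * z"] by simp
    then have "complex_of_real (cmod (1 - of_real r * z)) powr (2 * a)
        = (1 - of_real r * z) powr a * (1 - of_real r * cnj z) powr a"
      by (subst cmod_powr_eq_mult_cnj) auto
    then show ?thesis using z by (auto intro!: tendsto_mult g_lim)
  qed
  have meas[measurable]: "(\<lambda>x. g N (X x)) \<in> borel_measurable M" "(\<lambda>x. g N (cnj (X x))) \<in> borel_measurable M" for N
    unfolding g_def by measurable
  have int_mono: "integrable M (\<lambda>x. X x ^ j * cnj (X x) ^ k)" for j k
    using X_le_1 by (intro integrable_const_bound[where B = 1])
      (auto elim!: eventually_mono simp: norm_mult norm_power intro!: mult_le_one power_le_one)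
  have "(\<lambda>N. \<integral>x. g N (X x) * g N (cnj (X x)) \<partial>M) \<longlonglongrightarrow>
      (\<integral>x. complex_of_real (cmod (1 - of_real r * X x)) powr (2 * a) \<partial>M)"
  proof (rule integral_dominated_convergence[where w = "\<lambda>_. K * K"])
    show "AE x in M. cmod (g N (X x) * g N (cnj (X x))) \<le> K * K" for N
      using X_le_1 by eventually_elim (auto simp: norm_mult intro!: mult_mono g_bound K)
    show "AE x in M. (\<lambda>N. g N (X x) * g N (cnj (X x))) \<longlonglongrightarrow> complex_of_real (cmod (1 - of_real r * X x)) powr (2 * a)"
      using X_le_1 by eventually_elim (rule lim)
  qed auto
  moreover have "(\<integral>x. g N (X x) * g N (cnj (X x)) \<partial>M) =
      (\<Sum>k<N. of_real (measure M (space M) * beta_moment n k) * (a gchoose k)\<^sup>2 * of_real (r ^ (2 * k)))" for N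
  proof -
    let ?b = "\<lambda>k. (a gchoose k) * (- of_real r) ^ k"
    have diag: "(\<integral>x. X x ^ k * cnj (X x) ^ k \<partial>M) = of_real (measure M (space M) * beta_moment n k)" for k
    proof -
      have "X x ^ k * cnj (X x) ^ k = of_real (cmod (X x) ^ (2 * k))" for x
        by (simp add: power_mult_distrib[symmetric] complex_norm_square[symmetric] power_mult)
      then show ?thesis by (simp only: integral_complex_of_real X_moment)
    qed
    have "(\<integral>x. g N (X x) * g N (cnj (X x)) \<partial>M)
        = (\<integral>x. (\<Sum>j<N. \<Sum>k<N. ?b j * ?b k * (X x ^ j * cnj (X x) ^ k)) \<partial>M)"
      unfolding g_def sum_product power_mult_distrib by (simp only: mult_ac)
    also have "\<dots> = (\<Sum>j<N. \<Sum>k<N. ?b j * ?b k * (\<integral>x. X x ^ j * cnj (X x) ^ k \<partial>M))"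
      using int_mono by (simp add: Bochner_Integration.integral_sum)
    also have "\<dots> = (\<Sum>j<N. \<Sum>k<N. if k = j then ?b j * ?b j * of_real (measure M (space M) * beta_moment n j) else 0)"
      using X_cross diag by (intro sum.cong refl) auto
    also have "\<dots> = (\<Sum>j<N. ?b j * ?b j * of_real (measure M (space M) * beta_moment n j))"
      by simp
    also have "\<dots> = (\<Sum>k<N. of_real (measure M (space M) * beta_moment n k) * (a gchoose k)\<^sup>2 * of_real (r ^ (2 * k)))"
    proof (intro sum.cong refl)
      fix k
      have "(- of_real r) ^ k * (- of_real r) ^ k = complex_of_real (r ^ (2 * k))"
        by (simp add: power_add[symmetric] mult_2[symmetric])
      moreover have "?b k * ?b k * of_real (measure M (space M) * beta_moment n k)
          = of_real (measure M (space M) * beta_moment n k) * (a gchoose k)\<^sup>2 * ((- of_real r) ^ k * (- of_real r) ^ k)"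
        by (simp only: power2_eq_square mult_ac)
      ultimately show "?b k * ?b k * of_real (measure M (space M) * beta_moment n k)
          = of_real (measure M (space M) * beta_moment n k) * (a gchoose k)\<^sup>2 * of_real (r ^ (2 * k))"
        by (simp only:)
    qed
    finally show ?thesis .
  qed
  ultimately show ?thesis by (simp add: sums_def)
qed

text \<open>The expansion for exponent \<open>s\<close> with every beta moment and every power of
  \<open>r\<close> replaced by its upper bound 1: a bound uniform in the radius.\<close>

definition bound_const :: "real \<Rightarrow> real" where
  "bound_const s = measure M (space M) * (\<Sum>k. (cmod (complex_of_real (s / 2) gchoose k))\<^sup>2)"

lemma moment_inside_disc_le:
  assumes r: "0 \<le> r" "r < 1" and s: "s > - 1"
  shows "integrable M (\<lambda>x. cmod (1 - of_real r * X x) powr s)"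
    and "(\<integral>x. cmod (1 - of_real r * X x) powr s \<partial>M) \<le> bound_const s"
proof -
  define B where "B k = (cmod (complex_of_real (s / 2) gchoose k))\<^sup>2" for k
  have sumB: "summable B" using gbinomial_square_summable[of "complex_of_real (s / 2)"] s by (simp add: B_def[abs_def])
  let ?f = "\<lambda>k. of_real (measure M (space M) * beta_moment n k) * (complex_of_real (s / 2) gchoose k)\<^sup>2 * of_real (r ^ (2 * k))"
  have bd: "1 - r \<le> cmod (1 - of_real r * z) \<and> cmod (1 - of_real r * z) \<le> 2" if "cmod z \<le> 1" for z
  proof -
    have "cmod (of_real r * z) \<le> r" using r that by (simp add: norm_mult mult_left_le)
    then show ?thesis
      using norm_triangle_ineq2[of 1 "of_real r * z"] norm_triangle_ineq4[of 1 "of_real r * z"] r by simp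
  qed
  show "integrable M (\<lambda>x. cmod (1 - of_real r * X x) powr s)"
  proof (rule integrable_const_bound)
    show "AE x in M. norm (cmod (1 - of_real r * X x) powr s) \<le> (1 - r) powr s + 2 powr s"
      using X_le_1
    proof eventually_elim
      case (elim x)
      show ?case
      proof (cases "s \<ge> 0")
        case True
        then show ?thesis using bd[OF elim] by (auto intro!: add_increasing powr_mono2)
      next
        case False
        then show ?thesis using bd[OF elim] r by (auto intro!: add_increasing2 powr_mono2')
      qed
    qed
  qed simp
  have sums: "?f sums (\<integral>x. complex_of_real (cmod (1 - of_real r * X x)) powr (2 * (s / 2)) \<partial>M)"
    using expansion_inside_disc[OF r, of "of_real (s / 2)"] by simp
  have "complex_of_real (\<integral>x. cmod (1 - of_real r * X x) powr s \<partial>M) = (\<Sum>k. ?f k)"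
    using sums_unique[OF sums] by (simp add: powr_of_real)
  moreover have "cmod (\<Sum>k. ?f k) \<le> (\<Sum>k. measure M (space M) * B k)"
  proof -
    have le: "cmod (?f k) \<le> measure M (space M) * B k" for k
    proof -
      have "cmod (?f k) = measure M (space M) * (beta_moment n k * r ^ (2 * k)) * B k"
        using beta_moment_pos[OF n_pos, of k] r by (simp add: norm_mult norm_power B_def)
      also have "\<dots> \<le> measure M (space M) * 1 * B k"
        using beta_moment_pos[OF n_pos, of k] beta_moment_le_1[OF n_pos, of k] r
        by (intro mult_right_mono mult_left_mono mult_le_one power_le_one) (auto simp: B_def)
      finally show ?thesis by simp
    qed
    have sumMB: "summable (\<lambda>k. measure M (space M) * B k)" using sumB by (rule summable_mult)
    have sumf: "summable (\<lambda>k. cmod (?f k))"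
      by (rule summable_comparison_test'[OF sumMB, of 0]) (simp only: real_norm_def abs_norm_cancel le)
    show ?thesis
      by (rule order_trans[OF summable_norm[OF sumf] suminf_le[OF le sumf sumMB]])
  qed
  ultimately have "cmod (complex_of_real (\<integral>x. cmod (1 - of_real r * X x) powr s \<partial>M)) \<le> (\<Sum>k. measure M (space M) * B k)"
    by (simp only:)
  then have "(\<integral>x. cmod (1 - of_real r * X x) powr s \<partial>M) \<le> measure M (space M) * suminf B"
    unfolding suminf_mult[OF sumB] norm_of_real by (rule order_trans[OF abs_ge_self])
  then show "(\<integral>x. cmod (1 - of_real r * X x) powr s \<partial>M) \<le> bound_const s"
    unfolding bound_const_def B_def[abs_def] .
qed

text \<open>An atom of \<open>X\<close> at 1 would contribute its mass times
  \<open>(1 - r) powr (- 1/2)\<close> to the moment of order \<open>- 1/2\<close>, which stays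
  bounded as \<open>r\<close> tends to 1. The atom must be excluded because the value
  \<open>0 powr t = 0\<close> spoils the pointwise limit at \<open>X = 1\<close> when
  \<open>Re t <= 0\<close>.\<close>

lemma X_neq_1: "AE x in M. X x \<noteq> 1"
proof -
  define A where "A = {x \<in> space M. X x = 1}"
  have A[measurable]: "A \<in> sets M" unfolding A_def by measurable
  have le: "measure M A * real (Suc m) powr (1/2) \<le> bound_const (- 1/2)" for m
  proof -
    let ?r = "1 - 1 / real (Suc m)"
    have r: "0 \<le> ?r" "?r < 1" by (auto simp: field_simps)
    have "measure M A * real (Suc m) powr (1/2) = (\<integral>x. real (Suc m) powr (1/2) * indicator A x \<partial>M)"
      by simp
    also have "\<dots> \<le> (\<integral>x. cmod (1 - of_real ?r * X x) powr (- 1/2) \<partial>M)"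
    proof (intro integral_mono moment_inside_disc_le r)
      fix x assume "x \<in> space M"
      show "real (Suc m) powr (1/2) * indicator A x \<le> cmod (1 - of_real ?r * X x) powr (- 1/2)"
        by (auto simp: A_def indicator_def powr_minus powr_divide norm_divide divide_simps simp del: of_nat_Suc)
    qed (use A in \<open>auto intro!: integrable_mult_right integrable_real_indicator simp: emeasure_eq_measure\<close>)
    also have "\<dots> \<le> bound_const (- 1/2)" by (rule moment_inside_disc_le[OF r]) simp
    finally show ?thesis .
  qed
  have "measure M A = 0"
  proof (rule ccontr)
    assume "measure M A \<noteq> 0"
    then have pos: "measure M A > 0" by (simp add: zero_less_measure_iff)
    have "filterlim (\<lambda>m. real (Suc m) powr (1/2)) at_top sequentially"
      unfolding powr_half_sqrt[OF of_nat_0_le_iff]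
      by (intro filterlim_compose[OF sqrt_at_top] filterlim_compose[OF filterlim_real_sequentially filterlim_Suc])
    then have "\<forall>\<^sub>F m in sequentially. real (Suc m) powr (1/2) > bound_const (- 1/2) / measure M A"
      by (simp add: filterlim_at_top_dense)
    then obtain m where "real (Suc m) powr (1/2) > bound_const (- 1/2) / measure M A"
      by (auto dest: eventually_happens)
    with le[of m] pos show False by (simp add: field_simps)
  qed
  then show ?thesis
    using A by (intro AE_I[of _ _ A]) (auto simp: A_def emeasure_eq_measure)
qed

text \<open>Since \<open>1 - r <= cmod (1 - r * z)\<close>, the triangle inequality gives
  \<open>cmod (1 - z) <= 2 * cmod (1 - r * z)\<close>, which settles negative \<open>s\<close>; for
  \<open>s >= 0\<close> the modulus is at most 2. The result is a majorant uniform in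
  \<open>r\<close>.\<close>

lemma dominate_inside_disc:
  assumes "0 \<le> r" "r < 1" "cmod z \<le> 1" "z \<noteq> 1"
  shows "cmod (1 - of_real r * z) powr s \<le> 2 powr \<bar>s\<bar> * (1 + cmod (1 - z) powr s)"
proof -
  have rz: "cmod (of_real r * z) \<le> r" using assms by (simp add: norm_mult mult_left_le)
  have lo: "1 - r \<le> cmod (1 - of_real r * z)" and up: "cmod (1 - of_real r * z) \<le> 2"
    using rz norm_triangle_ineq2[of 1 "of_real r * z"] norm_triangle_ineq4[of 1 "of_real r * z"] assms by simp_all
  have "1 - z = (1 - of_real r * z) - of_real (1 - r) * z" by (simp add: algebra_simps)
  then have "cmod (1 - z) \<le> cmod (1 - of_real r * z) + cmod (of_real (1 - r) * z)"
    by (metis norm_triangle_ineq4)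
  also have "cmod (of_real (1 - r) * z) \<le> 1 - r"
    using assms by (simp only: norm_mult norm_of_real) (simp add: mult_left_le)
  finally have half: "cmod (1 - z) / 2 \<le> cmod (1 - of_real r * z)" using lo by simp
  show ?thesis
  proof (cases "s \<ge> 0")
    case True
    then have "cmod (1 - of_real r * z) powr s \<le> 2 powr \<bar>s\<bar> * 1"
      using up by (auto intro!: powr_mono2)
    also have "\<dots> \<le> 2 powr \<bar>s\<bar> * (1 + cmod (1 - z) powr s)"
      by (intro mult_left_mono) auto
    finally show ?thesis .
  next
    case False
    then have "cmod (1 - of_real r * z) powr s \<le> (cmod (1 - z) / 2) powr s"
      using half assms by (intro powr_mono2') auto
    also have "\<dots> = 2 powr \<bar>s\<bar> * cmod (1 - z) powr s"
      using False by (simp add: powr_divide powr_minus_divide)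
    also have "\<dots> \<le> 2 powr \<bar>s\<bar> * (1 + cmod (1 - z) powr s)"
      by (intro mult_left_mono) auto
    finally show ?thesis .
  qed
qed

lemma radii: "0 \<le> 1 - 1 / real (Suc m)" "1 - 1 / real (Suc m) < 1" 
  "(\<lambda>m. 1 - 1 / real (Suc m)) \<longlonglongrightarrow> 1"
proof -
  have "(\<lambda>m. 1 - inverse (real (Suc m))) \<longlonglongrightarrow> 1 - 0"
    by (intro tendsto_diff tendsto_const LIMSEQ_inverse_real_of_nat)
  then show "(\<lambda>m. 1 - 1 / real (Suc m)) \<longlonglongrightarrow> 1" by (simp add: inverse_eq_divide)
qed (auto simp: field_simps)

text \<open>Fatou's lemma along radii tending to 1, with the uniform bound
  \<open>bound_const\<close>.\<close>

lemma integrable_abs_one_minus_powr: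
  assumes s: "s > - 1"
  shows "integrable M (\<lambda>x. cmod (1 - X x) powr s)"
proof (rule integrableI_bounded)
  let ?r = "\<lambda>m. 1 - 1 / real (Suc m)"
  have lim: "AE x in M. (\<lambda>m. ennreal (cmod (1 - of_real (?r m) * X x) powr s)) \<longlonglongrightarrow> ennreal (cmod (1 - X x) powr s)"
    using X_neq_1
  proof eventually_elim
    case (elim x)
    have "(\<lambda>m. cmod (1 - of_real (?r m) * X x) powr s) \<longlonglongrightarrow> cmod (1 - of_real 1 * X x) powr s"
      using elim by (intro tendsto_powr tendsto_norm tendsto_diff tendsto_mult tendsto_const tendsto_of_real radii) auto
    then show ?case by (intro tendsto_ennrealI) simp
  qed
  have "(\<integral>\<^sup>+x. ennreal (norm (cmod (1 - X x) powr s)) \<partial>M)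
      = (\<integral>\<^sup>+x. liminf (\<lambda>m. ennreal (cmod (1 - of_real (?r m) * X x) powr s)) \<partial>M)"
    using lim by (intro nn_integral_cong_AE) (auto elim!: eventually_mono simp: lim_imp_Liminf[symmetric] simp del: of_nat_Suc)
  also have "\<dots> \<le> liminf (\<lambda>m. \<integral>\<^sup>+x. ennreal (cmod (1 - of_real (?r m) * X x) powr s) \<partial>M)"
    by (intro nn_integral_liminf) simp
  also have "\<dots> \<le> liminf (\<lambda>m::nat. ennreal (bound_const s))"
  proof (intro Liminf_mono always_eventually allI)
    fix m
    show "(\<integral>\<^sup>+x. ennreal (cmod (1 - of_real (?r m) * X x) powr s) \<partial>M) \<le> ennreal (bound_const s)"
      using moment_inside_disc_le[OF radii(1,2) s, of m] by (subst nn_integral_eq_integral) (auto intro: ennreal_leI)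
  qed
  also have "\<dots> = ennreal (bound_const s)" by (simp add: Liminf_const)
  also have "\<dots> < \<infinity>" by simp
  finally show "(\<integral>\<^sup>+x. ennreal (norm (cmod (1 - X x) powr s)) \<partial>M) < \<infinity>" .
qed simp

text \<open>The radius tends to 1 on both sides of \<open>expansion_inside_disc\<close> at
  \<open>a = t / 2\<close>: dominated convergence treats the integrals, Tannery's theorem the
  series, whose value at radius 1 is \<open>gauss_sum\<close>.\<close>

theorem one_minus_moment:
  fixes t :: complex
  assumes t: "Re t > - 1"
  shows "integrable M (\<lambda>x. complex_of_real (cmod (1 - X x)) powr t)"
    and "(\<integral>x. complex_of_real (cmod (1 - X x)) powr t \<partial>M) = of_real (measure M (space M)) *
      (Gamma (of_nat n) * Gamma (of_nat n + t) / (Gamma (of_nat n + t / 2))\<^sup>2)"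
proof -
  let ?r = "\<lambda>m. 1 - 1 / real (Suc m)"
  let ?w = "\<lambda>x. 2 powr \<bar>Re t\<bar> * (1 + cmod (1 - X x) powr Re t)"
  let ?f = "\<lambda>k. of_real (measure M (space M) * beta_moment n k) * ((t/2) gchoose k)\<^sup>2"
  have w: "integrable M ?w" using integrable_abs_one_minus_powr[OF t] by simp
  have lim: "AE x in M. (\<lambda>m. complex_of_real (cmod (1 - of_real (?r m) * X x)) powr t) \<longlonglongrightarrow> complex_of_real (cmod (1 - X x)) powr t"
    using X_neq_1
  proof eventually_elim
    case (elim x)
    then have "complex_of_real (cmod (1 - of_real 1 * X x)) \<notin> \<real>\<^sub>\<le>\<^sub>0"
      by simp
    then have "(\<lambda>m. complex_of_real (cmod (1 - of_real (?r m) * X x)) powr t) \<longlonglongrightarrow> complex_of_real (cmod (1 - of_real 1 * X x)) powr t"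
      by (intro tendsto_powr_complex tendsto_of_real tendsto_norm tendsto_diff tendsto_mult tendsto_const radii)
    then show ?case by simp
  qed
  have bd: "AE x in M. norm (complex_of_real (cmod (1 - of_real (?r m) * X x)) powr t) \<le> ?w x" for m
    using X_neq_1 X_le_1
  proof eventually_elim
    case (elim x)
    show ?case
      unfolding norm_of_real_powr[OF norm_ge_zero]
      by (rule dominate_inside_disc[OF radii(1,2) elim(2,1)])
  qed
  have meas: "(\<lambda>x. complex_of_real (cmod (1 - X x)) powr t) \<in> borel_measurable M"
    "(\<lambda>x. complex_of_real (cmod (1 - of_real (?r m) * X x)) powr t) \<in> borel_measurable M" for m
    by measurable
  show "integrable M (\<lambda>x. complex_of_real (cmod (1 - X x)) powr t)"
    by (rule integrable_dominated_convergence[OF meas w lim bd])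
  have eqn: "(\<integral>x. complex_of_real (cmod (1 - of_real (?r m) * X x)) powr t \<partial>M) = (\<Sum>k. ?f k * of_real (?r m ^ (2 * k)))" for m
    using sums_unique[OF expansion_inside_disc[OF radii(1,2), of "t/2"]] by simp
  have "(\<lambda>m. \<integral>x. complex_of_real (cmod (1 - of_real (?r m) * X x)) powr t \<partial>M) \<longlonglongrightarrow>
      (\<integral>x. complex_of_real (cmod (1 - X x)) powr t \<partial>M)"
    by (rule integral_dominated_convergence[OF meas w lim bd])
  then have 1: "(\<lambda>m. \<Sum>k. ?f k * of_real (?r m ^ (2 * k))) \<longlonglongrightarrow> (\<integral>x. complex_of_real (cmod (1 - X x)) powr t \<partial>M)"
    unfolding eqn .
  have 2: "(\<lambda>m. \<Sum>k. ?f k * of_real (?r m ^ (2 * k))) \<longlonglongrightarrow> (\<Sum>k. ?f k)"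
  proof (rule tannerys_theorem[THEN conjunct2, THEN conjunct2])
    show "(\<lambda>m. ?f k * of_real (?r m ^ (2 * k))) \<longlonglongrightarrow> ?f k" for k
    proof -
      have "(\<lambda>m. ?f k * of_real (?r m ^ (2 * k))) \<longlonglongrightarrow> ?f k * of_real (1 ^ (2 * k))"
        by (intro tendsto_mult tendsto_const tendsto_of_real tendsto_power radii)
      then show ?thesis by simp
    qed
    show "summable (\<lambda>k. measure M (space M) * (cmod ((t/2) gchoose k))\<^sup>2)"
      using t by (intro summable_mult gbinomial_square_summable) simp
    show "\<forall>\<^sub>F (k, m) in sequentially \<times>\<^sub>F sequentially.
        cmod (?f k * of_real (?r m ^ (2 * k))) \<le> measure M (space M) * (cmod ((t/2) gchoose k))\<^sup>2"
    proof (intro always_eventually allI, clarify)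
      fix k m
      have "cmod (?f k * of_real (?r m ^ (2 * k)))
          = measure M (space M) * (beta_moment n k * ?r m ^ (2 * k)) * (cmod ((t/2) gchoose k))\<^sup>2"
      proof -
        have "cmod (of_real (?r m ^ (2 * k))) = ?r m ^ (2 * k)"
          using radii(1)[of m] by (simp only: norm_of_real) simp
        moreover have "cmod (of_real (measure M (space M) * beta_moment n k)) = measure M (space M) * beta_moment n k"
          using beta_moment_pos[OF n_pos, of k] by (simp only: norm_of_real) simp
        ultimately show ?thesis by (simp only: norm_mult norm_power mult_ac)
      qed
      also have "\<dots> \<le> measure M (space M) * 1 * (cmod ((t/2) gchoose k))\<^sup>2"
        using beta_moment_pos[OF n_pos, of k] beta_moment_le_1[OF n_pos, of k] radii(1)[of m] radii(2)[of m]
        by (intro mult_right_mono mult_left_mono mult_le_one power_le_one) auto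
      finally show "cmod (?f k * of_real (?r m ^ (2 * k))) \<le> measure M (space M) * (cmod ((t/2) gchoose k))\<^sup>2"
        by simp
    qed
  qed simp
  have 3: "?f sums (of_real (measure M (space M)) *
      (Gamma (of_nat n) * Gamma (of_nat n + t) / (Gamma (of_nat n + t / 2))\<^sup>2))"
    using sums_mult[OF gauss_sum[OF n_pos, of "t/2"], of "of_real (measure M (space M))"] t
    by (simp add: mult.assoc)
  show "(\<integral>x. complex_of_real (cmod (1 - X x)) powr t \<partial>M) = of_real (measure M (space M)) *
      (Gamma (of_nat n) * Gamma (of_nat n + t) / (Gamma (of_nat n + t / 2))\<^sup>2)"
    unfolding LIMSEQ_unique[OF 1 2] by (rule sums_unique[OF 3, symmetric])
qed

end

subsection \<open>Schur complements of unitary matrices\<close>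

text \<open>A one-sided inverse of a square matrix is two-sided, so orthonormal columns
  suffice.\<close>

lemma unitary_group_iff:
  fixes A :: "complex ^ 'n ^ 'n"
  shows "A \<in> unitary_group \<longleftrightarrow> (\<forall>i j. (\<Sum>k\<in>UNIV. cnj (A $ k $ i) * A $ k $ j) = (if i = j then 1 else 0))"
proof -
  have "A \<in> unitary_group \<longleftrightarrow> conj_transpose A ** A = mat 1"
    unfolding unitary_group_def using matrix_left_right_inverse by auto
  also have "\<dots> \<longleftrightarrow> (\<forall>i j. (\<Sum>k\<in>UNIV. cnj (A $ k $ i) * A $ k $ j) = (if i = j then 1 else 0))"
    by (simp add: vec_eq_iff matrix_matrix_mult_def conj_transpose_def mat_def)
  finally show ?thesis .
qed

lemma unitary_group_columns:
  "A \<in> unitary_group \<Longrightarrow> (\<Sum>k\<in>UNIV. cnj (A $ k $ i) * A $ k $ j) = (if i = j then 1 else 0)"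
  by (simp add: unitary_group_iff)

lemma unitary_group_rows:
  assumes "A \<in> unitary_group"
  shows "(\<Sum>k\<in>UNIV. A $ i $ k * cnj (A $ j $ k)) = (if i = j then 1 else 0)"
proof -
  have "A ** conj_transpose A = mat 1" using assms by (simp add: unitary_group_def)
  then show ?thesis by (simp add: vec_eq_iff matrix_matrix_mult_def conj_transpose_def mat_def)
qed

lemma unitary_group_column_norm:
  assumes "A \<in> unitary_group"
  shows "(\<Sum>k\<in>UNIV. (cmod (A $ k $ j))\<^sup>2) = 1"
proof -
  have "complex_of_real (\<Sum>k\<in>UNIV. (cmod (A $ k $ j))\<^sup>2) = (\<Sum>k\<in>UNIV. cnj (A $ k $ j) * A $ k $ j)"
    by (simp add: complex_norm_square mult.commute del: of_real_power)
  also have "\<dots> = of_real 1" using unitary_group_columns[OF assms, of j j] by simp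
  finally show ?thesis by (simp only: of_real_eq_iff)
qed

lemma unitary_group_row_norm:
  assumes "A \<in> unitary_group"
  shows "(\<Sum>k\<in>UNIV. (cmod (A $ i $ k))\<^sup>2) = 1"
proof -
  have "complex_of_real (\<Sum>k\<in>UNIV. (cmod (A $ i $ k))\<^sup>2) = (\<Sum>k\<in>UNIV. A $ i $ k * cnj (A $ i $ k))"
    by (simp add: complex_norm_square del: of_real_power)
  also have "\<dots> = of_real 1" using unitary_group_rows[OF assms, of i i] by simp
  finally show ?thesis by (simp only: of_real_eq_iff)
qed

lemma unitary_group_entry_le_1:
  assumes "A \<in> unitary_group"
  shows "cmod (A $ i $ j) \<le> 1"
proof -
  have "(cmod (A $ i $ j))\<^sup>2 \<le> (\<Sum>k\<in>UNIV. (cmod (A $ k $ j))\<^sup>2)"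
    by (rule member_le_sum) auto
  then show ?thesis using unitary_group_column_norm[OF assms, of j] by (simp add: power_le_one_iff)
qed

text \<open>An entry 1 exhausts the norm of its row and of its column. This settles the degenerate
  case of the Schur complement, where the denominator is 0.\<close>

lemma unitary_group_diagonal_1:
  assumes A: "A \<in> unitary_group" and s: "A $ s $ s = 1" and ij: "i = s \<or> j = s"
  shows "A $ i $ j = (if i = j then 1 else 0)"
proof -
  have "A $ k $ s = 0" if "k \<noteq> s" for k
  proof -
    have "(\<Sum>k\<in>UNIV - {s}. (cmod (A $ k $ s))\<^sup>2) = 0"
      using unitary_group_column_norm[OF A, of s] s by (simp add: sum.remove[of UNIV s])
    then show ?thesis using that by (simp add: sum_nonneg_eq_0_iff)
  qed
  moreover have "A $ s $ k = 0" if "k \<noteq> s" for k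
  proof -
    have "(\<Sum>k\<in>UNIV - {s}. (cmod (A $ s $ k))\<^sup>2) = 0"
      using unitary_group_row_norm[OF A, of s] s by (simp add: sum.remove[of UNIV s])
    then show ?thesis using that by (simp add: sum_nonneg_eq_0_iff)
  qed
  ultimately show ?thesis using ij s by auto
qed

text \<open>A copy of the unitary group on the coordinates in \<open>S\<close>, acting trivially on
  the others. All dimensions thus live in one matrix type, and the induction on the dimension runs
  over \<open>S\<close>.\<close>

definition block_unitary :: "'n set \<Rightarrow> (complex ^ 'n ^ 'n) set" where
  "block_unitary S = {A \<in> unitary_group. \<forall>i j. i \<notin> S \<or> j \<notin> S \<longrightarrow> A $ i $ j = (if i = j then 1 else 0)}"

lemma block_unitary_UNIV [simp]: "block_unitary UNIV = unitary_group"
  by (simp add: block_unitary_def)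

lemma block_unitary_mono: "S \<subseteq> T \<Longrightarrow> block_unitary S \<subseteq> block_unitary T"
  by (auto simp: block_unitary_def)

text \<open>The Schur complement of the \<open>s\<close> entry of \<open>A - 1\<close>, plus the identity. For unitary \<open>A\<close> it is
  \<open>R\<^sup>-\<^sup>1 A\<close>, where \<open>R\<close> is the unitary rank-one perturbation of the identity
  that sends the basis vector \<open>e\<^sub>s\<close> to \<open>A e\<^sub>s\<close>. If the \<open>s\<close> entry of \<open>A\<close> is 1, the division by zero
  yields \<open>A\<close> itself.\<close>

definition schur :: "'n \<Rightarrow> complex ^ 'n ^ 'n \<Rightarrow> complex ^ 'n ^ 'n" where
  "schur s A = (\<chi> i j. A $ i $ j - (A $ i $ s - mat 1 $ i $ s) * (A $ s $ j - mat 1 $ s $ j) / (A $ s $ s - 1))"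

text \<open>With \<open>c = A e_s - e_s\<close> the matrix is a rank-one update
  \<open>A - c b^T\<close>. Orthonormality of the columns gives the inner products of
  \<open>c\<close> with the columns of \<open>A\<close> and with itself; the squared norm
  \<open>- (d + cnj d)\<close> cancels the two cross terms.\<close>

lemma schur_unitary:
  assumes A: "A \<in> unitary_group"
  shows "schur s A \<in> unitary_group"
proof (cases "A $ s $ s = 1")
  case True
  then have "schur s A = A" by (simp add: schur_def vec_eq_iff)
  with A show ?thesis by simp
next
  case False
  define d where "d = A $ s $ s - 1"
  define c where "c k = A $ k $ s - mat 1 $ k $ s" for k
  define b where "b j = (A $ s $ j - mat 1 $ s $ j) / d" for j
  have d: "d \<noteq> 0" using False by (simp add: d_def)
  have H: "schur s A $ k $ j = A $ k $ j - c k * b j" for k j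
    by (simp add: schur_def c_def b_def d_def)
  have c1: "(\<Sum>k\<in>UNIV. cnj (A $ k $ i) * c k) = - cnj (b i * d)" for i
  proof -
    have "(\<Sum>k\<in>UNIV. cnj (A $ k $ i) * c k) = (\<Sum>k\<in>UNIV. cnj (A $ k $ i) * A $ k $ s) - (\<Sum>k\<in>UNIV. cnj (A $ k $ i) * mat 1 $ k $ s)"
      by (simp add: c_def right_diff_distrib sum_subtractf)
    also have "(\<Sum>k\<in>UNIV. cnj (A $ k $ i) * mat 1 $ k $ s) = cnj (A $ s $ i)"
      by (simp add: mat_def if_distrib[of "\<lambda>x. _ * x"] cong: if_cong)
    finally show ?thesis
      using d by (auto simp: unitary_group_columns[OF A] b_def mat_def)
  qed
  have c2: "(\<Sum>k\<in>UNIV. cnj (c k) * A $ k $ j) = - (b j * d)" for j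
  proof -
    have "(\<Sum>k\<in>UNIV. cnj (c k) * A $ k $ j) = cnj (\<Sum>k\<in>UNIV. cnj (A $ k $ j) * c k)"
      by (simp add: mult.commute)
    then show ?thesis by (simp add: c1)
  qed
  have c3: "(\<Sum>k\<in>UNIV. cnj (c k) * c k) = - (d + cnj d)"
  proof -
    have "(\<Sum>k\<in>UNIV. cnj (c k) * c k) = (\<Sum>k\<in>UNIV. cnj (c k) * A $ k $ s) - (\<Sum>k\<in>UNIV. cnj (c k) * mat 1 $ k $ s)"
      by (simp add: c_def right_diff_distrib sum_subtractf)
    also have "(\<Sum>k\<in>UNIV. cnj (c k) * mat 1 $ k $ s) = cnj (c s)"
      by (simp add: mat_def if_distrib[of "\<lambda>x. _ * x"] cong: if_cong)
    finally have "(\<Sum>k\<in>UNIV. cnj (c k) * c k) = - (b s * d) - cnj (c s)" by (simp only: c2)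
    then show ?thesis using d by (simp add: b_def c_def mat_def) (simp add: d_def)
  qed
  show ?thesis
    unfolding unitary_group_iff
  proof (intro allI)
    fix i j
    have "(\<Sum>k\<in>UNIV. cnj (schur s A $ k $ i) * schur s A $ k $ j)
      = (\<Sum>k\<in>UNIV. cnj (A $ k $ i) * A $ k $ j - (cnj (A $ k $ i) * c k) * b j
          - cnj (b i) * (cnj (c k) * A $ k $ j) + cnj (b i) * b j * (cnj (c k) * c k))"
      by (intro sum.cong refl) (simp add: H algebra_simps)
    also have "\<dots> = (\<Sum>k\<in>UNIV. cnj (A $ k $ i) * A $ k $ j) - (\<Sum>k\<in>UNIV. cnj (A $ k $ i) * c k) * b j
          - cnj (b i) * (\<Sum>k\<in>UNIV. cnj (c k) * A $ k $ j) + cnj (b i) * b j * (\<Sum>k\<in>UNIV. cnj (c k) * c k)"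
      by (simp add: sum.distrib sum_subtractf sum_distrib_left sum_distrib_right)
    also have "\<dots> = (if i = j then 1 else 0)"
      unfolding c1 c2 c3 unitary_group_columns[OF A] by (simp add: algebra_simps)
    finally show "(\<Sum>k\<in>UNIV. cnj (schur s A $ k $ i) * schur s A $ k $ j) = (if i = j then 1 else 0)" .
  qed
qed

text \<open>If \<open>A $ s $ s\<close> is not 1, elimination clears row and column
  \<open>s\<close>; otherwise unitarity has already cleared them.\<close>

lemma schur_block_unitary:
  assumes A: "A \<in> block_unitary S"
  shows "schur s A \<in> block_unitary (S - {s})"
proof -
  from A have U: "A \<in> unitary_group" by (simp add: block_unitary_def)
  have off: "A $ i $ j = (if i = j then 1 else 0)" if "i \<notin> S \<or> j \<notin> S" for i j
    using A that by (auto simp: block_unitary_def)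
  have "schur s A $ i $ j = (if i = j then 1 else 0)" if ij: "i \<notin> S - {s} \<or> j \<notin> S - {s}" for i j
  proof (cases "i = s \<or> j = s")
    case True
    then show ?thesis
      using unitary_group_diagonal_1[OF U, of s]
      by (cases "A $ s $ s = 1") (auto simp: schur_def mat_def)
  next
    case False
    with ij have "i \<notin> S \<or> j \<notin> S" by auto
    with False show ?thesis using off[of i j] off[of i s] off[of s j] by (auto simp: schur_def mat_def)
  qed
  with schur_unitary[OF U] show ?thesis by (simp add: block_unitary_def)
qed

lemma block_unitary_mult_row:
  assumes U: "U \<in> block_unitary S" and s: "s \<notin> S"
  shows "(U ** A) $ s $ j = A $ s $ j"
proof -
  have "(U ** A) $ s $ j = (\<Sum>k\<in>UNIV. (if s = k then 1 else 0) * A $ k $ j)"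
    unfolding matrix_matrix_mult_def using U s by (simp add: block_unitary_def)
  also have "\<dots> = (\<Sum>k\<in>UNIV. if s = k then A $ k $ j else 0)"
    by (intro sum.cong refl) simp
  finally show ?thesis by simp
qed

text \<open>As \<open>U\<close> has trivial row and column \<open>s\<close>, row \<open>s\<close> of
  \<open>A\<close> is unchanged and the vector \<open>A e_s - e_s\<close> is multiplied by
  \<open>U\<close>. Hence the rank-one correction is multiplied by \<open>U\<close> as well.\<close>

lemma schur_equivariant:
  assumes U: "U \<in> block_unitary S" and s: "s \<notin> S"
  shows "schur s (U ** A) = U ** schur s A"
proof -
  have row: "(U ** A) $ s $ j = A $ s $ j" for j
    by (rule block_unitary_mult_row[OF U s])
  have col: "(U ** A) $ i $ s - mat 1 $ i $ s = (\<Sum>k\<in>UNIV. U $ i $ k * (A $ k $ s - mat 1 $ k $ s))" for i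
  proof -
    have "(\<Sum>k\<in>UNIV. U $ i $ k * mat 1 $ k $ s) = U $ i $ s"
      by (simp add: mat_def if_distrib[of "\<lambda>x. _ * x"] cong: if_cong)
    also have "\<dots> = mat 1 $ i $ s" using U s by (simp add: block_unitary_def mat_def)
    finally show ?thesis
      by (simp add: right_diff_distrib sum_subtractf matrix_matrix_mult_def)
  qed
  have "schur s (U ** A) $ i $ j = (U ** schur s A) $ i $ j" for i j
  proof -
    define x y where "x k = A $ k $ s - mat 1 $ k $ s" and "y = (A $ s $ j - mat 1 $ s $ j) / (A $ s $ s - 1)" for k
    have "schur s (U ** A) $ i $ j = (U ** A) $ i $ j - (\<Sum>k\<in>UNIV. U $ i $ k * x k) * y"
      using col by (simp add: schur_def row x_def y_def)
    also have "\<dots> = (\<Sum>k\<in>UNIV. U $ i $ k * (A $ k $ j - x k * y))"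
      by (simp add: matrix_matrix_mult_def right_diff_distrib sum_subtractf sum_distrib_right mult.assoc)
    also have "\<dots> = (U ** schur s A) $ i $ j"
      by (simp add: matrix_matrix_mult_def schur_def x_def y_def)
    finally show ?thesis .
  qed
  then show ?thesis by (simp add: vec_eq_iff)
qed

text \<open>Gaussian elimination in the form \<open>M = C ** (M' ** E)\<close>: \<open>C\<close> is
  the identity with column \<open>s\<close> taken from \<open>M\<close>, and \<open>E\<close> the
  identity with row \<open>s\<close> taken from \<open>M\<close> and divided by the pivot. Their
  determinants are the pivot and 1.\<close>

lemma det_schur_complement:
  fixes M :: "complex ^ 'n ^ 'n"
  assumes d: "M $ s $ s \<noteq> 0"
  shows "det M = M $ s $ s *
    det (\<chi> i j. if i = s \<or> j = s then mat 1 $ i $ j else M $ i $ j - M $ i $ s * M $ s $ j / M $ s $ s)"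
proof -
  define M' :: "complex ^ 'n ^ 'n" where
    "M' = (\<chi> i j. if i = s \<or> j = s then mat 1 $ i $ j else M $ i $ j - M $ i $ s * M $ s $ j / M $ s $ s)"
  define C :: "complex ^ 'n ^ 'n" where "C = (\<chi> i j. if j = s then M $ i $ s else mat 1 $ i $ j)"
  define E :: "complex ^ 'n ^ 'n" where "E = (\<chi> i j. if i = s then M $ s $ j / M $ s $ s else mat 1 $ i $ j)"
  have "det C = M $ s $ s"
  proof -
    \<comment> \<open>Cramer's lemma for the identity matrix: replacing its column \<open>s\<close>
      by a vector gives the \<open>s\<close> coordinate of that vector as determinant.\<close>
    have "C = (\<chi> i j. if j = s then (mat 1 *v column s M) $ i else mat 1 $ i $ j)"
      by (simp add: C_def column_def vec_eq_iff)
    then show ?thesis using cramer_lemma[of s "mat 1 :: complex ^ 'n ^ 'n" "column s M"] by (simp add: column_def)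
  qed
  moreover have "det E = 1"
  proof -
    have "transpose E = (\<chi> i j. if j = s then (mat 1 *v (\<chi> j. M $ s $ j / M $ s $ s)) $ i else mat 1 $ i $ j)"
      unfolding matrix_vector_mul_lid by (auto simp add: E_def transpose_def vec_eq_iff mat_def)
    then have "det (transpose E) = (\<chi> j. M $ s $ j / M $ s $ s) $ s * det (mat 1 :: complex ^ 'n ^ 'n)"
      using cramer_lemma[of s "mat 1 :: complex ^ 'n ^ 'n" "\<chi> j. M $ s $ j / M $ s $ s"] by simp
    then show ?thesis using d by (simp add: det_transpose)
  qed
  moreover have "M = C ** (M' ** E)"
  proof -
    have ME: "(M' ** E) $ k $ j = (if k = s then M $ s $ j / M $ s $ s else if j = s then 0 else M' $ k $ j)" for k j
    proof (cases "k = s")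
      case True
      then show ?thesis
        by (simp add: matrix_matrix_mult_def M'_def E_def mat_def if_distrib[of "\<lambda>x. x * _"] cong: if_cong)
    next
      case False
      have "(M' ** E) $ k $ j = (\<Sum>l\<in>UNIV. if l = j then (if j = s then 0 else M' $ k $ j) else 0)"
        unfolding matrix_matrix_mult_def vec_lambda_beta using False
        by (intro sum.cong refl) (auto simp: M'_def E_def mat_def)
      then show ?thesis using False by simp
    qed
    have "(C ** (M' ** E)) $ i $ j = M $ i $ j" for i j
    proof -
      have "(C ** (M' ** E)) $ i $ j = C $ i $ s * (M' ** E) $ s $ j + (\<Sum>k\<in>UNIV - {s}. C $ i $ k * (M' ** E) $ k $ j)"
        by (simp add: matrix_matrix_mult_def sum.remove[of UNIV s])
      also have "(\<Sum>k\<in>UNIV - {s}. C $ i $ k * (M' ** E) $ k $ j) = (\<Sum>k\<in>UNIV - {s}. if i = k then (M' ** E) $ i $ j else 0)"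
        by (intro sum.cong refl) (auto simp: C_def mat_def)
      also have "\<dots> = (if i = s then 0 else (M' ** E) $ i $ j)" by simp
      finally have "(C ** (M' ** E)) $ i $ j = C $ i $ s * (M' ** E) $ s $ j + (if i = s then 0 else (M' ** E) $ i $ j)" .
      then show ?thesis unfolding ME using d by (auto simp: C_def M'_def mat_def)
    qed
    then show ?thesis by (simp add: vec_eq_iff)
  qed
  ultimately have "det M = M $ s $ s * det M'" by (metis det_mul mult.right_neutral)
  then show ?thesis by (simp only: M'_def)
qed

text \<open>The determinant of the \<open>S\<close>-block of \<open>1 - A\<close>, kept at full
  size: unit vectors in the columns outside \<open>S\<close> make the matrix block
  triangular.\<close>

definition block_det :: "'n set \<Rightarrow> complex ^ 'n ^ 'n \<Rightarrow> complex" where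
  "block_det S A = det (\<chi> i j. if j \<in> S then mat 1 $ i $ j - A $ i $ j else mat 1 $ i $ j)"

lemma block_det_empty [simp]: "block_det {} A = 1"
proof -
  have "(\<chi> i j. mat 1 $ i $ j) = (mat 1 :: complex ^ 'n ^ 'n)" by (simp add: vec_eq_iff)
  then show ?thesis by (simp add: block_det_def)
qed

lemma block_det_UNIV: "block_det UNIV A = Z A"
proof -
  have "(\<chi> i j. mat 1 $ i $ j - A $ i $ j) = mat 1 - A" by (simp add: vec_eq_iff)
  then show ?thesis by (simp add: block_det_def Z_def)
qed

text \<open>Eliminating the pivot \<open>1 - A $ s $ s\<close> turns the padded matrix for
  \<open>S\<close> and \<open>A\<close> into the one for \<open>S - {s}\<close> and
  \<open>schur s A\<close>. If the pivot is 0, unitarity makes all of column \<open>s\<close> vanish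
  and both sides are 0.\<close>

lemma block_det_schur:
  fixes A :: "complex ^ 'n ^ 'n"
  assumes A: "A \<in> block_unitary S" and s: "s \<in> S"
  shows "block_det S A = (1 - A $ s $ s) * block_det (S - {s}) (schur s A)"
proof (cases "A $ s $ s = 1")
  case True
  from A have U: "A \<in> unitary_group" by (simp add: block_unitary_def)
  have "column s (\<chi> i j. if j \<in> S then mat 1 $ i $ j - A $ i $ j else mat 1 $ i $ j) = 0"
    using unitary_group_diagonal_1[OF U True] s by (simp add: column_def vec_eq_iff mat_def)
  then have "block_det S A = 0" unfolding block_det_def by (rule det_zero_column)
  with True show ?thesis by simp
next
  case False
  define M :: "complex ^ 'n ^ 'n" where "M = (\<chi> i j. if j \<in> S then mat 1 $ i $ j - A $ i $ j else mat 1 $ i $ j)"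
  have H: "schur s A \<in> block_unitary (S - {s})" by (rule schur_block_unitary[OF A])
  have off: "A $ i $ j = (if i = j then 1 else 0)" if "i \<notin> S \<or> j \<notin> S" for i j
    using A that by (auto simp: block_unitary_def)
  have offH: "schur s A $ i $ j = (if i = j then 1 else 0)" if "i = s \<or> j = s" for i j
    using H that by (auto simp: block_unitary_def)
  have Mss: "M $ s $ s = 1 - A $ s $ s" using s by (simp add: M_def mat_def)
  have "(if i = s \<or> j = s then mat 1 $ i $ j else M $ i $ j - M $ i $ s * M $ s $ j / M $ s $ s)
     = (if j \<in> S - {s} then mat 1 $ i $ j - schur s A $ i $ j else mat 1 $ i $ j)" for i j
  proof (cases "i = s \<or> j = s")
    case True
    then show ?thesis using offH[of i j] by (auto simp: mat_def)
  next
    case False': False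
    have "M $ i $ j - M $ i $ s * M $ s $ j / M $ s $ s = mat 1 $ i $ j - schur s A $ i $ j" if "j \<in> S"
    proof -
      have "M $ i $ s = - (A $ i $ s - mat 1 $ i $ s)" "M $ s $ j = - (A $ s $ j - mat 1 $ s $ j)"
        "M $ s $ s = - (A $ s $ s - 1)" "M $ i $ j = mat 1 $ i $ j - A $ i $ j"
        using that s by (simp_all add: M_def Mss mat_def)
      then have "M $ i $ j - M $ i $ s * M $ s $ j / M $ s $ s = mat 1 $ i $ j - A $ i $ j
          + (A $ i $ s - mat 1 $ i $ s) * (A $ s $ j - mat 1 $ s $ j) / (A $ s $ s - 1)"
        by (simp only: minus_mult_minus divide_minus_right diff_minus_eq_add)
      then show ?thesis by (simp add: schur_def)
    qed
    moreover have "M $ i $ j - M $ i $ s * M $ s $ j / M $ s $ s = mat 1 $ i $ j" if "j \<notin> S"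
      using that False' by (simp add: M_def mat_def)
    ultimately show ?thesis using False' by auto
  qed
  then have "det M = M $ s $ s * block_det (S - {s}) (schur s A)"
    using False det_schur_complement[of M s] by (simp add: Mss block_det_def)
  then show ?thesis unfolding Mss by (simp add: block_det_def M_def)
qed

section \<open>Phase matrices and plane rotations\<close>

definition phase_matrix :: "'n \<Rightarrow> complex \<Rightarrow> complex ^ 'n ^ 'n" where
  "phase_matrix s w = (\<chi> i j. if i = j then (if i = s then w else 1) else 0)"

lemma phase_matrix_unitary:
  assumes "cmod w = 1" "s \<in> S"
  shows "phase_matrix s w \<in> block_unitary S"
proof -
  have "cnj w * w = 1" using assms by (simp add: mult.commute complex_norm_square[symmetric])
  then have "phase_matrix s w \<in> unitary_group"
    unfolding unitary_group_iff
    by (auto simp: phase_matrix_def if_distrib[of "\<lambda>x. x * _"] if_distrib[of cnj] cong: if_cong)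
  with assms show ?thesis by (auto simp: block_unitary_def phase_matrix_def)
qed

lemma phase_matrix_mult: "(phase_matrix s w ** A) $ i $ j = (if i = s then w else 1) * A $ i $ j"
proof -
  have "(phase_matrix s w ** A) $ i $ j = (\<Sum>k\<in>UNIV. if i = k then (if i = s then w else 1) * A $ i $ j else 0)"
    unfolding matrix_matrix_mult_def phase_matrix_def vec_lambda_beta by (intro sum.cong refl) simp
  then show ?thesis by simp
qed

definition rotation_matrix :: "'n \<Rightarrow> 'n \<Rightarrow> real \<Rightarrow> real \<Rightarrow> complex ^ 'n ^ 'n" where
  "rotation_matrix s l c d = (\<chi> i j.
     if j = s then (if i = s then of_real c else if i = l then of_real (- d) else 0)
     else if j = l then (if i = s then of_real d else if i = l then of_real c else 0)
     else if i = j then 1 else 0)"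

lemma sum_UNIV_two:
  fixes f :: "'n::finite \<Rightarrow> complex"
  assumes "s \<noteq> l"
  shows "(\<Sum>k\<in>UNIV. f k) = f s + f l + (\<Sum>k\<in>UNIV - {s, l}. f k)"
  using assms by (simp add: sum.remove[of UNIV s] sum.remove[of "UNIV - {s}" l] Diff_insert2[symmetric] insert_commute add.assoc)

lemma rotation_matrix_unitary:
  assumes sl: "s \<noteq> l" "s \<in> S" "l \<in> S" and cd: "c\<^sup>2 + d\<^sup>2 = 1"
  shows "rotation_matrix s l c d \<in> block_unitary S"
proof -
  have cd': "complex_of_real c * of_real c + of_real d * of_real d = 1"
    using cd by (simp add: power2_eq_square flip: of_real_mult of_real_add)
  have "rotation_matrix s l c d \<in> unitary_group"
    unfolding unitary_group_iff
  proof (intro allI)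
    fix i j
    let ?R = "rotation_matrix s l c d"
    have rest: "(\<Sum>k\<in>UNIV - {s, l}. cnj (?R $ k $ i) * ?R $ k $ j)
        = (\<Sum>k\<in>UNIV - {s, l}. if k = i then (if i = j then 1 else 0) else 0)"
      by (intro sum.cong refl) (auto simp: rotation_matrix_def)
    have "(\<Sum>k\<in>UNIV - {s, l}. cnj (?R $ k $ i) * ?R $ k $ j)
        = (if i \<in> UNIV - {s, l} \<and> i = j then 1 else 0)"
      unfolding rest by (subst sum.delta) auto
    note sum = sum_UNIV_two[OF sl(1), of "\<lambda>k. cnj (?R $ k $ i) * ?R $ k $ j", unfolded this]
    show "(\<Sum>k\<in>UNIV. cnj (?R $ k $ i) * ?R $ k $ j) = (if i = j then 1 else 0)"
    proof (cases "i = s \<or> i = l")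
      case False
      then have "s \<noteq> i" "l \<noteq> i" by auto
      with False show ?thesis using sl(1) unfolding sum by (simp add: rotation_matrix_def)
    next
      case True
      show ?thesis
      proof (cases "j = s \<or> j = l")
        case False
        with True show ?thesis using sl(1) unfolding sum by (simp add: rotation_matrix_def) auto
      next
        case j: True
        have l: "l \<noteq> s" using sl(1) by simp
        from True j consider "i = s" "j = s" | "i = s" "j = l" | "i = l" "j = s" | "i = l" "j = l" by blast
        then show ?thesis
          using sl(1) l cd' unfolding sum by cases (simp_all add: rotation_matrix_def add.commute)
      qed
    qed
  qed
  then show ?thesis using sl by (auto simp: block_unitary_def rotation_matrix_def)
qed

lemma rotation_matrix_mult:
  assumes "s \<noteq> l"
  shows "(rotation_matrix s l c d ** A) $ s $ j = of_real c * A $ s $ j + of_real d * A $ l $ j"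
proof -
  have "(\<Sum>k\<in>UNIV - {s, l}. rotation_matrix s l c d $ s $ k * A $ k $ j) = 0"
    by (intro sum.neutral) (auto simp: rotation_matrix_def)
  then show ?thesis
    using assms unfolding matrix_matrix_mult_def
    by (simp add: sum_UNIV_two[OF assms]) (simp add: rotation_matrix_def)
qed

subsection \<open>Left invariant measures\<close>

lemma borel_measurable_matrix:
  fixes f :: "'a \<Rightarrow> complex ^ 'n ^ 'm"
  assumes "\<And>i j. (\<lambda>x. f x $ i $ j) \<in> borel_measurable M"
  shows "f \<in> borel_measurable M"
proof (subst borel_measurable_euclidean_space, intro ballI)
  fix b :: "complex ^ 'n ^ 'm" assume "b \<in> Basis"
  then obtain i j c where b: "b = axis i (axis j c)"
    by (auto simp: Basis_vec_def)
  have "(\<lambda>x. f x $ i $ j \<bullet> c) \<in> borel_measurable M"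
    using assms by (intro borel_measurable_inner) auto
  then show "(\<lambda>x. f x \<bullet> b) \<in> borel_measurable M"
    by (simp add: b inner_axis)
qed

lemma borel_measurable_entry [measurable]:
  assumes [measurable]: "f \<in> borel_measurable M"
  shows "(\<lambda>x. (f x :: complex ^ 'n ^ 'm) $ i $ j) \<in> borel_measurable M"
  by (rule measurable_compose[OF assms]) (intro borel_measurable_continuous_onI continuous_intros)

lemma borel_measurable_matrix_mult [measurable]:
  "(\<lambda>A :: complex ^ 'n ^ 'n. U ** A) \<in> borel_measurable borel"
  by (rule borel_measurable_matrix) (simp add: matrix_matrix_mult_def)

lemma borel_measurable_schur [measurable]: "schur s \<in> borel_measurable borel"
  by (rule borel_measurable_matrix) (simp add: schur_def)

lemma borel_measurable_block_det [measurable]: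
  "block_det (S :: 'n::finite set) \<in> borel_measurable borel"
proof -
  have "(\<lambda>A :: complex ^ 'n ^ 'n. if j \<in> S then mat 1 $ i $ j - A $ i $ j else mat 1 $ i $ j) \<in> borel_measurable borel" for i j
    by measurable
  then show ?thesis
    unfolding block_det_def det_def by (auto intro!: borel_measurable_sum borel_measurable_times borel_measurable_prod)
qed

lemma closed_block_unitary: "closed (block_unitary S)"
proof -
  have "block_unitary S = {A. (\<forall>i j. (\<Sum>k\<in>UNIV. cnj (A $ k $ i) * A $ k $ j) = (if i = j then 1 else 0)) \<and>
      (\<forall>i j. i \<notin> S \<or> j \<notin> S \<longrightarrow> A $ i $ j = (if i = j then 1 else 0))}"
    by (auto simp: block_unitary_def unitary_group_iff)
  also have "closed \<dots>"
    by (intro closed_Collect_conj closed_Collect_all closed_Collect_eq closed_Collect_imp open_Collect_const continuous_intros)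
  finally show ?thesis .
qed

text \<open>A nonzero polynomial has finitely many roots. The identity is assumed only for
  \<open>x >= 0\<close> because \<open>x\<close> will be the squared tangent of an angle.\<close>

lemma polynomial_coefficients_eq:
  fixes c d :: "nat \<Rightarrow> real"
  assumes eq: "\<And>x. x \<ge> 0 \<Longrightarrow> (\<Sum>i\<le>n. c i * x ^ i) = (\<Sum>i\<le>n. d i * x ^ i)" and i: "i \<le> n"
  shows "c i = d i"
proof (rule ccontr)
  assume "c i \<noteq> d i"
  with i have "finite {x. (\<Sum>i\<le>n. (c i - d i) * x ^ i) = 0}"
    by (subst polyfun_finite_roots) auto
  moreover have "{0..} \<subseteq> {x. (\<Sum>i\<le>n. (c i - d i) * x ^ i) = 0}"
    using eq by (auto simp: left_diff_distrib sum_subtractf)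
  ultimately have "finite {0::real..}" by (rule finite_subset[rotated])
  then show False using infinite_Ici by blast
qed

text \<open>The measures live on the whole matrix space and are carried by the subgroup only almost
  everywhere, so \<open>S\<close> can shrink while the measurable space stays fixed. Finite mass
  instead of mass 1 admits the weighted measures that replace conditioning.\<close>

locale block_invariant = finite_measure \<mu> for \<mu> :: "(complex ^ 'n ^ 'n) measure" +
  fixes S :: "'n set"
  assumes sets_borel [measurable_cong]: "sets \<mu> = sets borel"
    and AE_block_unitary: "AE A in \<mu>. A \<in> block_unitary S"
    and invariant: "U \<in> block_unitary S \<Longrightarrow> distr \<mu> borel (\<lambda>A. U ** A) = \<mu>"
begin

lemma integral_invariant:
  fixes f :: "complex ^ 'n ^ 'n \<Rightarrow> 'b :: {banach, second_countable_topology}"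
  assumes "U \<in> block_unitary S" and [measurable]: "f \<in> borel_measurable borel"
  shows "(\<integral>A. f (U ** A) \<partial>\<mu>) = (\<integral>A. f A \<partial>\<mu>)"
  using integral_distr[of "\<lambda>A. U ** A" \<mu> borel f] invariant[OF assms(1)] by simp

lemma AE_entry_le_1: "AE A in \<mu>. cmod (A $ i $ j) \<le> 1"
  using AE_block_unitary
  by eventually_elim (simp add: block_unitary_def unitary_group_entry_le_1)

text \<open>The phase \<open>w\<close> is chosen with \<open>w^j * cnj w^k = -1\<close>. Multiplying
  row \<open>l\<close> by it preserves the measure and \<open>g\<close> but flips the sign of the
  integrand.\<close>

lemma phase_cross:
  assumes l: "l \<in> S" and jk: "j \<noteq> k" and [measurable]: "g \<in> borel_measurable borel"
    and g: "\<And>w A. cmod w = 1 \<Longrightarrow> g (phase_matrix l w ** A) = g A"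
  shows "(\<integral>A. g A * (A $ l $ p ^ j * cnj (A $ l $ p) ^ k) \<partial>\<mu>) = (0 :: complex)"
proof -
  define w where "w = cis (pi / (real j - real k))"
  have "w ^ j * cnj w ^ k = cis (real j * (pi / (real j - real k)) + real k * - (pi / (real j - real k)))"
    by (simp only: w_def cis_cnj Complex.DeMoivre cis_mult)
  also have "real j * (pi / (real j - real k)) + real k * - (pi / (real j - real k)) = pi"
  proof -
    have "real j * (pi / (real j - real k)) + real k * - (pi / (real j - real k))
        = (real j - real k) * (pi / (real j - real k))"
      by (simp only: left_diff_distrib)
    then show ?thesis using jk by simp
  qed
  finally have w: "w ^ j * cnj w ^ k = -1" by simp
  have "cmod w = 1" by (simp add: w_def)
  then have "(\<integral>A. g A * (A $ l $ p ^ j * cnj (A $ l $ p) ^ k) \<partial>\<mu>)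
      = (\<integral>A. g A * ((w * A $ l $ p) ^ j * cnj (w * A $ l $ p) ^ k) \<partial>\<mu>)"
    using integral_invariant[OF phase_matrix_unitary[of w l S], of "\<lambda>A. g A * (A $ l $ p ^ j * cnj (A $ l $ p) ^ k)"] l
    by (simp add: g phase_matrix_mult)
  also have "\<dots> = (\<integral>A. (w ^ j * cnj w ^ k) * (g A * (A $ l $ p ^ j * cnj (A $ l $ p) ^ k)) \<partial>\<mu>)"
    by (simp add: power_mult_distrib mult_ac)
  also have "\<dots> = - (\<integral>A. g A * (A $ l $ p ^ j * cnj (A $ l $ p) ^ k) \<partial>\<mu>)"
    by (simp add: w)
  finally show ?thesis by (simp add: complex_eq_iff)
qed

lemma integrable_entries:
  "integrable \<mu> (\<lambda>A. cmod (A $ i $ j) ^ a * cmod (A $ i' $ j') ^ b)"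
  using AE_entry_le_1[of i j] AE_entry_le_1[of i' j']
  by (intro integrable_const_bound[where B = 1])
    (auto elim!: eventually_elim2 simp: norm_mult norm_power intro!: mult_le_one power_le_one)

lemma integrable_entries_complex:
  "integrable \<mu> (\<lambda>A. (A $ i $ j ^ a * cnj (A $ i $ j) ^ b) * (A $ i' $ j' ^ a' * cnj (A $ i' $ j') ^ b'))"
  using AE_entry_le_1[of i j] AE_entry_le_1[of i' j']
  by (intro integrable_const_bound[where B = 1])
    (auto elim!: eventually_elim2 simp: norm_mult norm_power intro!: mult_le_one power_le_one)

text \<open>Rotating the rows \<open>s\<close> and \<open>l\<close> by an angle of tangent \<open>sqrt x\<close> leaves the moment on the right
  unchanged; this is an identity of polynomials in \<open>x\<close>, and the claim compares the coefficients
  of \<open>x\<close>.\<close>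

lemma rotation_moment:
  assumes sl: "s \<noteq> l" "s \<in> S" "l \<in> S"
  shows "real (Suc k) * (\<integral>A. cmod (A $ s $ s) ^ (2 * k) * cmod (A $ l $ s) ^ 2 \<partial>\<mu>)
    = (\<integral>A. cmod (A $ s $ s) ^ (2 * Suc k) \<partial>\<mu>)"
proof -
  define K where "K = Suc k"
  define m where "m = (\<integral>A. cmod (A $ s $ s) ^ (2 * K) \<partial>\<mu>)"
  define q where "q a = (\<integral>A. cmod (A $ s $ s) ^ (2 * (K - a)) * cmod (A $ l $ s) ^ (2 * a) \<partial>\<mu>)" for a
  have key: "(\<Sum>a\<le>K. (real (K choose a) * m) * x ^ a) = (\<Sum>a\<le>K. ((real (K choose a))\<^sup>2 * q a) * x ^ a)"
    if x: "x \<ge> 0" for x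
  proof -
    define e where "e = sqrt x"
    \<comment> \<open>\<open>c\<close> and \<open>c * e\<close> are cosine and sine of the angle
      with tangent \<open>e = sqrt x\<close>.\<close>
    define c where "c = 1 / sqrt (1 + x)"
    have e2: "e * e = x" using x by (simp add: e_def)
    have c2: "c\<^sup>2 * (1 + x) = 1" using x by (simp add: c_def power_divide)
    then have "c\<^sup>2 + (c * e)\<^sup>2 = 1"
      using e2 unfolding power2_eq_square by algebra
    note R = rotation_matrix_unitary[OF sl this]
    have "m = (\<integral>A. cmod (of_real c * A $ s $ s + of_real (c * e) * A $ l $ s) ^ (2 * K) \<partial>\<mu>)"
      using integral_invariant[OF R, of "\<lambda>A. cmod (A $ s $ s) ^ (2 * K)"]
      by (simp add: rotation_matrix_mult[OF sl(1)] m_def)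
    also have "\<dots> = (\<integral>A. (c\<^sup>2) ^ K * cmod (A $ s $ s + of_real e * A $ l $ s) ^ (2 * K) \<partial>\<mu>)"
    proof (intro Bochner_Integration.integral_cong refl)
      fix A :: "complex ^ 'n ^ 'n"
      have "of_real c * A $ s $ s + of_real (c * e) * A $ l $ s = of_real c * (A $ s $ s + of_real e * A $ l $ s)"
        by (simp add: distrib_left)
      then have "cmod (of_real c * A $ s $ s + of_real (c * e) * A $ l $ s) = \<bar>c\<bar> * cmod (A $ s $ s + of_real e * A $ l $ s)"
        by (simp only: norm_mult norm_of_real)
      then show "cmod (of_real c * A $ s $ s + of_real (c * e) * A $ l $ s) ^ (2 * K)
          = (c\<^sup>2) ^ K * cmod (A $ s $ s + of_real e * A $ l $ s) ^ (2 * K)"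
        by (simp only: power_mult_distrib power_mult power2_abs)
    qed
    also have "\<dots> = (c\<^sup>2) ^ K * (\<integral>A. cmod (A $ s $ s + of_real e * A $ l $ s) ^ (2 * K) \<partial>\<mu>)"
      by simp
    \<comment> \<open>The factor \<open>(1 + x)^K\<close> clears the cosines, since
      \<open>c^2 * (1 + x) = 1\<close>.\<close>
    finally have "(1 + x) ^ K * m = ((1 + x) * c\<^sup>2) ^ K * (\<integral>A. cmod (A $ s $ s + of_real e * A $ l $ s) ^ (2 * K) \<partial>\<mu>)"
      by (simp only: power_mult_distrib mult.assoc)
    then have m: "(1 + x) ^ K * m = (\<integral>A. cmod (A $ s $ s + of_real e * A $ l $ s) ^ (2 * K) \<partial>\<mu>)"
      using c2 by (simp add: mult.commute)
    define I where "I a b A = (A $ s $ s ^ (K - a) * cnj (A $ s $ s) ^ (K - b)) * (A $ l $ s ^ a * cnj (A $ l $ s) ^ b)"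
      for a b and A :: "complex ^ 'n ^ 'n"
    define cc where "cc a b = complex_of_real (real (K choose a) * real (K choose b) * e ^ (a + b))" for a b
    \<comment> \<open>A phase on row \<open>l\<close> kills the terms with distinct \<open>a\<close>
      and \<open>b\<close>; the others carry \<open>e^(2 * a) = x^a\<close>, so the square root
      disappears.\<close>
    have I0: "(\<integral>A. I a b A \<partial>\<mu>) = 0" if "a \<noteq> b" for a b
      unfolding I_def using sl(1)
      by (intro phase_cross[OF sl(3) that]) (auto simp: phase_matrix_mult)
    have I1: "(\<integral>A. I a a A \<partial>\<mu>) = of_real (q a)" for a
    proof -
      have "I a a A = of_real (cmod (A $ s $ s) ^ (2 * (K - a)) * cmod (A $ l $ s) ^ (2 * a))" for A
        by (simp add: I_def power_mult_distrib[symmetric] complex_norm_square[symmetric] power_mult)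
      then show ?thesis by (simp only: integral_complex_of_real q_def)
    qed
    have "of_real (cmod (A $ s $ s + of_real e * A $ l $ s) ^ (2 * K)) = (\<Sum>a\<le>K. \<Sum>b\<le>K. cc a b * I a b A)" for A
    proof -
      let ?z = "of_real e * A $ l $ s + A $ s $ s"
      have "of_real (cmod (A $ s $ s + of_real e * A $ l $ s) ^ (2 * K)) = ?z ^ K * (of_real e * cnj (A $ l $ s) + cnj (A $ s $ s)) ^ K"
      proof -
        have "?z ^ K * (of_real e * cnj (A $ l $ s) + cnj (A $ s $ s)) ^ K = (?z * cnj ?z) ^ K"
          by (simp add: power_mult_distrib)
        also have "\<dots> = of_real (cmod ?z ^ (2 * K))"
          by (simp only: complex_norm_square[symmetric] power_mult of_real_power)
        finally show ?thesis by (simp add: add.commute)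
      qed
      also have "\<dots> = (\<Sum>a\<le>K. \<Sum>b\<le>K. cc a b * I a b A)"
        unfolding binomial_ring sum_product
        by (intro sum.cong refl) (simp add: cc_def I_def power_mult_distrib power_add mult_ac)
      finally show ?thesis .
    qed
    then have "complex_of_real (\<integral>A. cmod (A $ s $ s + of_real e * A $ l $ s) ^ (2 * K) \<partial>\<mu>)
       = (\<integral>A. (\<Sum>a\<le>K. \<Sum>b\<le>K. cc a b * I a b A) \<partial>\<mu>)"
      by (simp only: integral_complex_of_real[symmetric])
    also have "\<dots> = (\<Sum>a\<le>K. \<Sum>b\<le>K. cc a b * (\<integral>A. I a b A \<partial>\<mu>))"
      using integrable_entries_complex unfolding I_def by (simp add: Bochner_Integration.integral_sum)
    also have "\<dots> = (\<Sum>a\<le>K. \<Sum>b\<le>K. if b = a then cc a a * of_real (q a) else 0)"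
      using I0 I1 by (intro sum.cong refl) auto
    also have "\<dots> = (\<Sum>a\<le>K. cc a a * of_real (q a))" by simp
    also have "\<dots> = of_real (\<Sum>a\<le>K. ((real (K choose a))\<^sup>2 * q a) * x ^ a)"
      unfolding of_real_sum
      by (intro sum.cong refl) (simp add: cc_def power2_eq_square power_add e2[symmetric] power_mult_distrib mult_ac)
    finally have "(\<integral>A. cmod (A $ s $ s + of_real e * A $ l $ s) ^ (2 * K) \<partial>\<mu>) = (\<Sum>a\<le>K. ((real (K choose a))\<^sup>2 * q a) * x ^ a)"
      by (simp only: of_real_eq_iff)
    moreover have "(1 + x) ^ K * m = (\<Sum>a\<le>K. (real (K choose a) * m) * x ^ a)"
      using binomial_ring[of x 1 K] by (simp add: add.commute sum_distrib_left mult_ac)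
    ultimately show ?thesis using m by simp
  qed
  \<comment> \<open>The coefficients of \<open>x\<close> give \<open>K * m = K^2 * q 1\<close>; the
    claim follows on dividing by \<open>K\<close>.\<close>
  have "real (K choose 1) * m = (real (K choose 1))\<^sup>2 * q 1"
    by (rule polynomial_coefficients_eq[OF key]) (auto simp: K_def)
  then show ?thesis by (simp add: K_def m_def q_def power2_eq_square del: of_nat_Suc)
qed

text \<open>Summing \<open>rotation_moment\<close> over the other rows in \<open>S\<close>, with
  column \<open>s\<close> of norm 1, gives
  \<open>(n - 1) * m (k+1) = (k+1) * (m k - m (k+1))\<close> for \<open>n = card S\<close>, which is
  the recursion of the beta moments.\<close>

lemma diagonal_moment:
  assumes s: "s \<in> S"
  shows "(\<integral>A. cmod (A $ s $ s) ^ (2 * k) \<partial>\<mu>) = measure \<mu> (space \<mu>) * beta_moment (card S) k"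
proof (induction k)
  case (Suc k)
  define m where "m k = (\<integral>A. cmod (A $ s $ s) ^ (2 * k) \<partial>\<mu>)" for k
  have n: "card S \<ge> 1" using s by (auto simp: Suc_le_eq card_gt_0_iff)
  have int: "integrable \<mu> (\<lambda>A. cmod (A $ s $ s) ^ (2 * k))" for k
    using integrable_entries[of s s "2 * k" s s 0] by simp
  have "(real (card S) - 1) * m (Suc k)
      = (\<Sum>l\<in>S - {s}. real (Suc k) * (\<integral>A. cmod (A $ s $ s) ^ (2 * k) * cmod (A $ l $ s) ^ 2 \<partial>\<mu>))"
  proof -
    have "(\<Sum>l\<in>S - {s}. real (Suc k) * (\<integral>A. cmod (A $ s $ s) ^ (2 * k) * cmod (A $ l $ s) ^ 2 \<partial>\<mu>))
        = (\<Sum>l\<in>S - {s}. m (Suc k))"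
      using s unfolding m_def by (intro sum.cong refl rotation_moment) auto
    then show ?thesis using s n by (simp add: of_nat_diff)
  qed
  also have "\<dots> = real (Suc k) * (\<integral>A. (\<Sum>l\<in>S - {s}. cmod (A $ s $ s) ^ (2 * k) * cmod (A $ l $ s) ^ 2) \<partial>\<mu>)"
    using integrable_entries by (subst Bochner_Integration.integral_sum) (auto simp: sum_distrib_left)
  also have "(\<integral>A. (\<Sum>l\<in>S - {s}. cmod (A $ s $ s) ^ (2 * k) * cmod (A $ l $ s) ^ 2) \<partial>\<mu>)
      = (\<integral>A. cmod (A $ s $ s) ^ (2 * k) - cmod (A $ s $ s) ^ (2 * Suc k) \<partial>\<mu>)"
  proof (rule integral_cong_AE)
    show "AE A in \<mu>. (\<Sum>l\<in>S - {s}. cmod (A $ s $ s) ^ (2 * k) * cmod (A $ l $ s) ^ 2)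
        = cmod (A $ s $ s) ^ (2 * k) - cmod (A $ s $ s) ^ (2 * Suc k)"
      using AE_block_unitary
    proof eventually_elim
      case (elim A)
      have "(\<Sum>l\<in>UNIV. (cmod (A $ l $ s))\<^sup>2) = (\<Sum>l\<in>S. (cmod (A $ l $ s))\<^sup>2)"
        using elim s by (intro sum.mono_neutral_right) (auto simp: block_unitary_def)
      then have "(\<Sum>l\<in>S - {s}. (cmod (A $ l $ s))\<^sup>2) = 1 - (cmod (A $ s $ s))\<^sup>2"
        using unitary_group_column_norm[of A s] elim s by (simp add: block_unitary_def sum_diff1)
      then show ?case
        by (simp add: sum_distrib_left[symmetric] right_diff_distrib power_add[symmetric])
    qed
  qed auto
  also have "\<dots> = m k - m (Suc k)"
    unfolding m_def by (intro Bochner_Integration.integral_diff int)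
  finally have "(real (card S) + real k) * m (Suc k) = real (Suc k) * m k"
    by (simp add: algebra_simps)
  then have "m (Suc k) = m k * (real (Suc k) / (real (card S) + real k))"
    using n by (simp add: field_simps)
  then show ?case using Suc.IH beta_moment_Suc[OF n, of k] by (simp add: m_def)
qed simp

lemma beta_moments_diagonal:
  assumes s: "s \<in> S"
  shows "beta_moments \<mu> (\<lambda>A. A $ s $ s) (card S)"
proof
  show "AE A in \<mu>. cmod (A $ s $ s) \<le> 1" by (rule AE_entry_le_1)
  show "(\<integral>A. A $ s $ s ^ j * cnj (A $ s $ s) ^ k \<partial>\<mu>) = 0" if "j \<noteq> k" for j k
    using phase_cross[OF s that, of "\<lambda>_. 1" s] by simp
  show "(\<integral>A. cmod (A $ s $ s) ^ (2 * k) \<partial>\<mu>) = measure \<mu> (space \<mu>) * beta_moment (card S) k" for k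
    by (rule diagonal_moment[OF s])
  show "1 \<le> card S" using s by (auto simp: Suc_le_eq card_gt_0_iff)
qed measurable

text \<open>Conditionally on its \<open>s\<close> entry, the Schur complement is again invariant.\<close>

lemma block_invariant_schur:
  assumes s: "s \<in> S" and h [measurable]: "h \<in> borel_measurable borel"
    and h_nonneg: "\<And>z. h z \<ge> 0" and h_int: "integrable \<mu> (\<lambda>A. h (A $ s $ s))"
  shows "block_invariant (distr (density \<mu> (\<lambda>A. ennreal (h (A $ s $ s)))) borel (schur s)) (S - {s})"
proof -
  let ?f = "\<lambda>A :: complex ^ 'n ^ 'n. ennreal (h (A $ s $ s))"
  let ?D = "density \<mu> ?f"
  let ?\<nu> = "distr ?D borel (schur s)"
  interpret \<nu>: finite_measure ?\<nu>
  proof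
    have "emeasure ?\<nu> (space ?\<nu>) = (\<integral>\<^sup>+A. ?f A \<partial>\<mu>)"
      using sets_eq_imp_space_eq[OF sets_borel]
      by (subst emeasure_distr) (auto simp: emeasure_density space_density cong: nn_integral_cong)
    also have "\<dots> = ennreal (\<integral>A. h (A $ s $ s) \<partial>\<mu>)"
      using h_int h_nonneg by (intro nn_integral_eq_integral) auto
    finally show "emeasure ?\<nu> (space ?\<nu>) \<noteq> \<infinity>" by simp
  qed
  show ?thesis
  proof
    show "AE A in ?\<nu>. A \<in> block_unitary (S - {s})"
      using AE_block_unitary
      by (subst AE_distr_iff) (auto simp: AE_density borel_closed[OF closed_block_unitary] schur_block_unitary elim!: eventually_mono)
    show "distr ?\<nu> borel ((**) U) = ?\<nu>" if U: "U \<in> block_unitary (S - {s})" for U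
    proof -
      have "U \<in> block_unitary S" using U block_unitary_mono[of "S - {s}" S] by auto
      \<comment> \<open>The weight depends on \<open>A\<close> only through an entry that
        \<open>U\<close> leaves fixed, so the weighted measure is invariant under \<open>U\<close>;
        equivariance of \<open>schur\<close> carries this over to the image.\<close>
      then have "?D = density (distr \<mu> borel (\<lambda>A. U ** A)) ?f" by (simp add: invariant)
      also have "\<dots> = distr (density \<mu> (\<lambda>A. ?f (U ** A))) borel (\<lambda>A. U ** A)"
        by (subst density_distr) auto
      also have "\<dots> = distr ?D borel (\<lambda>A. U ** A)"
        by (simp add: block_unitary_mult_row[OF U])
      finally have D: "distr ?D borel (\<lambda>A. U ** A) = ?D" by simp
      have "distr ?\<nu> borel (\<lambda>A. U ** A) = distr ?D borel (\<lambda>A. U ** schur s A)"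
        by (subst distr_distr) (auto simp: comp_def)
      also have "\<dots> = distr ?D borel (\<lambda>A. schur s (U ** A))"
        using schur_equivariant[OF U, of s] by simp
      also have "\<dots> = distr (distr ?D borel (\<lambda>A. U ** A)) borel (schur s)"
        by (subst distr_distr) (auto simp: comp_def)
      finally show ?thesis by (simp add: D)
    qed
  qed simp
qed

text \<open>Weighting \<open>\<mu>\<close> by a nonnegative function of the entry and mapping by
  \<open>schur\<close> gives an invariant measure whose mass is the integral of the weight, so the
  assumption on \<open>g\<close> yields the factorisation; this takes the place of conditional
  expectation. Complex \<open>w\<close> is reached through real and imaginary, then positive and
  negative parts.\<close>

lemma schur_independent:
  fixes g :: "complex ^ 'n ^ 'n \<Rightarrow> complex" and w :: "complex \<Rightarrow> complex"
  assumes s: "s \<in> S" and [measurable]: "g \<in> borel_measurable borel" "w \<in> borel_measurable borel"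
    and g: "\<And>\<nu>. block_invariant \<nu> (S - {s}) \<Longrightarrow>
      integrable \<nu> g \<and> (\<integral>A. g A \<partial>\<nu>) = of_real (measure \<nu> (space \<nu>)) * c"
    and w: "integrable \<mu> (\<lambda>A. w (A $ s $ s))"
  shows "integrable \<mu> (\<lambda>A. w (A $ s $ s) * g (schur s A))"
    and "(\<integral>A. w (A $ s $ s) * g (schur s A) \<partial>\<mu>) = (\<integral>A. w (A $ s $ s) \<partial>\<mu>) * c"
proof -
  have nonneg: "has_bochner_integral \<mu> (\<lambda>A. of_real (h (A $ s $ s)) * g (schur s A)) (of_real (\<integral>A. h (A $ s $ s) \<partial>\<mu>) * c)"
    if [measurable]: "h \<in> borel_measurable borel" and h: "\<And>z. h z \<ge> 0" "integrable \<mu> (\<lambda>A. h (A $ s $ s))"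
    for h :: "complex \<Rightarrow> real"
  proof -
    let ?D = "density \<mu> (\<lambda>A. ennreal (h (A $ s $ s)))"
    let ?\<nu> = "distr ?D borel (schur s)"
    have g\<nu>: "integrable ?\<nu> g" "(\<integral>A. g A \<partial>?\<nu>) = of_real (measure ?\<nu> (space ?\<nu>)) * c"
      using g[OF block_invariant_schur[OF s _ h]] by auto
    have "measure ?\<nu> (space ?\<nu>) = (\<integral>A. h (A $ s $ s) \<partial>\<mu>)"
    proof -
      have "emeasure ?\<nu> (space ?\<nu>) = (\<integral>\<^sup>+A. ennreal (h (A $ s $ s)) \<partial>\<mu>)"
        using sets_eq_imp_space_eq[OF sets_borel]
        by (subst emeasure_distr) (auto simp: emeasure_density space_density cong: nn_integral_cong)
      also have "\<dots> = ennreal (\<integral>A. h (A $ s $ s) \<partial>\<mu>)"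
        using h by (intro nn_integral_eq_integral) auto
      finally show ?thesis using h by (simp add: measure_def)
    qed
    moreover have "integrable \<mu> (\<lambda>A. h (A $ s $ s) *\<^sub>R g (schur s A))"
      using g\<nu>(1) h by (subst (asm) integrable_distr_eq) (auto simp: integrable_density)
    moreover have "(\<integral>A. g A \<partial>?\<nu>) = (\<integral>A. h (A $ s $ s) *\<^sub>R g (schur s A) \<partial>\<mu>)"
      using h by (subst integral_distr) (auto simp: integral_density)
    ultimately show ?thesis using g\<nu>(2) by (simp add: has_bochner_integral_iff scaleR_conv_of_real)
  qed
  define wp where "wp f z = max 0 (f (w z))" for f :: "complex \<Rightarrow> real" and z
  have part: "has_bochner_integral \<mu> (\<lambda>A. of_real (f (w (A $ s $ s))) * g (schur s A))
      (of_real (\<integral>A. f (w (A $ s $ s)) \<partial>\<mu>) * c)"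
    if f: "bounded_linear f" for f :: "complex \<Rightarrow> real"
  proof -
    have f_meas[measurable]: "f \<in> borel_measurable borel"
      using f by (intro borel_measurable_continuous_onI linear_continuous_on)
    have int_f: "integrable \<mu> (\<lambda>A. f (w (A $ s $ s)))"
      using integrable_bounded_linear[OF f w] .
    have 1: "has_bochner_integral \<mu> (\<lambda>A. of_real (wp f (A $ s $ s)) * g (schur s A)) (of_real (\<integral>A. wp f (A $ s $ s) \<partial>\<mu>) * c)"
      using int_f by (intro nonneg) (auto simp: wp_def)
    have 2: "has_bochner_integral \<mu> (\<lambda>A. of_real (wp (\<lambda>z. - f z) (A $ s $ s)) * g (schur s A)) (of_real (\<integral>A. wp (\<lambda>z. - f z) (A $ s $ s) \<partial>\<mu>) * c)"
      using int_f by (intro nonneg) (auto simp: wp_def)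
    have dec: "f (w z) = wp f z - wp (\<lambda>z. - f z) z" for z by (simp add: wp_def max_def)
    have "(\<integral>A. f (w (A $ s $ s)) \<partial>\<mu>) = (\<integral>A. wp f (A $ s $ s) \<partial>\<mu>) - (\<integral>A. wp (\<lambda>z. - f z) (A $ s $ s) \<partial>\<mu>)"
      unfolding dec using int_f by (intro Bochner_Integration.integral_diff) (auto simp: wp_def)
    then show ?thesis
      using has_bochner_integral_diff[OF 1 2] by (simp add: dec left_diff_distrib)
  qed
  have "has_bochner_integral \<mu> (\<lambda>A. of_real (Re (w (A $ s $ s))) * g (schur s A) + \<i> * (of_real (Im (w (A $ s $ s))) * g (schur s A)))
     (of_real (\<integral>A. Re (w (A $ s $ s)) \<partial>\<mu>) * c + \<i> * (of_real (\<integral>A. Im (w (A $ s $ s)) \<partial>\<mu>) * c))"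
    by (intro has_bochner_integral_add has_bochner_integral_mult_right part bounded_linear_Re bounded_linear_Im)
  moreover have "(of_real (Re z) * u + \<i> * (of_real (Im z) * u)) = z * u" for z u
    by (simp add: complex_eq_iff)
  moreover have "of_real (\<integral>A. Re (w (A $ s $ s)) \<partial>\<mu>) * c + \<i> * (of_real (\<integral>A. Im (w (A $ s $ s)) \<partial>\<mu>) * c) = (\<integral>A. w (A $ s $ s) \<partial>\<mu>) * c"
    using w by (simp add: complex_eq_iff integral_Re integral_Im)
  ultimately have "has_bochner_integral \<mu> (\<lambda>A. w (A $ s $ s) * g (schur s A)) ((\<integral>A. w (A $ s $ s) \<partial>\<mu>) * c)"
    by simp
  then show "integrable \<mu> (\<lambda>A. w (A $ s $ s) * g (schur s A))"
    and "(\<integral>A. w (A $ s $ s) * g (schur s A) \<partial>\<mu>) = (\<integral>A. w (A $ s $ s) \<partial>\<mu>) * c"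
    by (simp_all add: has_bochner_integral_iff)
qed

end

text \<open>Induction on \<open>S\<close>, one Schur complement per step. Since the claim covers all
  invariant finite measures, the induction hypothesis is exactly the assumption on \<open>g\<close>
  in \<open>schur_independent\<close>, with the product for the smaller set as \<open>c\<close>; the
  new factor comes from \<open>one_minus_moment\<close>.\<close>

theorem block_det_moment:
  fixes t :: complex and S :: "'n::finite set"
  assumes t: "Re t > - 1"
  shows "block_invariant \<mu> S \<Longrightarrow>
    integrable \<mu> (\<lambda>A. complex_of_real (cmod (block_det S A)) powr t) \<and>
    (\<integral>A. complex_of_real (cmod (block_det S A)) powr t \<partial>\<mu>) = of_real (measure \<mu> (space \<mu>)) *
      (\<Prod>j = 1..card S. Gamma (of_nat j) * Gamma (of_nat j + t) / (Gamma (of_nat j + t / 2))\<^sup>2)"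
  using finite[of S]
proof (induction S arbitrary: \<mu> rule: finite_induct)
  case empty
  then interpret block_invariant \<mu> "{} :: 'n set" .
  show ?case by (simp add: scaleR_conv_of_real)
next
  case (insert s S)
  interpret block_invariant \<mu> "insert s S" by fact
  interpret beta_moments \<mu> "\<lambda>A. A $ s $ s" "card (insert s S)"
    by (rule beta_moments_diagonal) simp
  have S: "insert s S - {s} = S" using insert.hyps by simp
  let ?w = "\<lambda>z. complex_of_real (cmod (1 - z)) powr t"
  let ?g = "\<lambda>A :: complex ^ 'n ^ 'n. complex_of_real (cmod (block_det S A)) powr t"
  have split: "AE A in \<mu>. complex_of_real (cmod (block_det (insert s S) A)) powr t = ?w (A $ s $ s) * ?g (schur s A)"
    using AE_block_unitary
  proof eventually_elim
    case (elim A)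
    have "block_det (insert s S) A = (1 - A $ s $ s) * block_det S (schur s A)"
      using block_det_schur[OF elim, of s] unfolding S by simp
    then show ?case by (simp add: norm_mult powr_times_real)
  qed
  note indep = schur_independent[of s ?g ?w, unfolded S, OF _ _ _ insert.IH one_minus_moment(1)[OF t]]
  have "integrable \<mu> (\<lambda>A. complex_of_real (cmod (block_det (insert s S) A)) powr t)"
    using indep(1) by (subst integrable_cong_AE[OF _ _ split]) auto
  moreover have "(\<integral>A. complex_of_real (cmod (block_det (insert s S) A)) powr t \<partial>\<mu>) = (\<integral>A. ?w (A $ s $ s) * ?g (schur s A) \<partial>\<mu>)"
    by (rule integral_cong_AE[OF _ _ split]) auto
  ultimately show ?case
    using indep(2) one_minus_moment(2)[OF t] insert.hyps by (simp add: prod.nat_ivl_Suc' mult_ac)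
qed

subsection \<open>Gamma variables and the identity in law\<close>

text \<open>The Mellin kernel. The absolute value makes it multiplicative on the whole real line, so
  positivity of the random variables enters only when logarithms are taken.\<close>

definition abs_powr :: "complex \<Rightarrow> real \<Rightarrow> complex" where
  "abs_powr s x = complex_of_real \<bar>x\<bar> powr s"

lemma abs_powr_cmod: "abs_powr s (cmod z) = complex_of_real (cmod z) powr s"
  by (simp add: abs_powr_def)

lemma borel_measurable_abs_powr [measurable]: "abs_powr s \<in> borel_measurable borel"
proof -
  have "abs_powr s = (\<lambda>x. complex_of_real (cmod (complex_of_real x)) powr s)"
    by (simp add: abs_powr_def fun_eq_iff)
  also have "\<dots> \<in> borel_measurable borel" by measurable
  finally show ?thesis .
qed

lemma abs_powr_mult: "abs_powr s (x * y) = abs_powr s x * abs_powr s y"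
  by (simp add: abs_powr_def abs_mult powr_times_real)

lemma abs_powr_1 [simp]: "abs_powr s 1 = 1"
  by (simp add: abs_powr_def)

lemma abs_powr_prod: "finite I \<Longrightarrow> abs_powr s (\<Prod>i\<in>I. x i) = (\<Prod>i\<in>I. abs_powr s (x i))"
  by (induction I rule: finite_induct) (simp_all add: abs_powr_mult)

lemma abs_powr_sqrt: "abs_powr s (sqrt x) = abs_powr (s / 2) x"
proof (cases "x = 0")
  case False
  \<comment> \<open>\<open>sqrt\<close> is extended oddly to negative arguments; the absolute value
    removes the sign.\<close>
  have "\<bar>sqrt x\<bar> = sqrt \<bar>x\<bar>" by (simp add: real_sqrt_abs2 real_sqrt_minus abs_if)
  with False show ?thesis by (simp add: abs_powr_def powr_def Ln_of_real ln_sqrt)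
qed (simp add: abs_powr_def)

lemma abs_powr_imaginary: "x > 0 \<Longrightarrow> abs_powr (\<i> * of_real u) x = iexp (u * ln x)"
  by (simp add: abs_powr_def powr_def Ln_of_real mult.assoc)

lemma gamma_density_nonneg: "a > 0 \<Longrightarrow> gamma_density a t \<ge> 0"
  by (simp add: gamma_density_def)

text \<open>Euler's integral for \<open>Gamma\<close> at \<open>a + s\<close>, divided by the
  normalising constant of the density.\<close>

lemma gamma_density_moment:
  assumes a: "a > 0" and s: "Re s > - a"
  shows "integrable lborel (\<lambda>t. gamma_density a t *\<^sub>R abs_powr s t)"
    and "(\<integral>t. gamma_density a t *\<^sub>R abs_powr s t \<partial>lborel) = Gamma (of_real a + s) / Gamma (of_real a)"
proof -
  let ?z = "of_real a + s"
  let ?f = "\<lambda>t::real. complex_of_real t powr (?z - 1) / of_real (exp t)"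
  have z: "Re ?z > 0" using s by simp
  have eq: "gamma_density a t *\<^sub>R abs_powr s t = (indicator {0<..} t *\<^sub>R ?f t) / Gamma (of_real a)" for t
  proof (cases "t > 0")
    case True
    then have "complex_of_real (t powr (a - 1)) * of_real t powr s = of_real t powr (?z - 1)"
      by (simp add: powr_of_real[symmetric] powr_add[symmetric] algebra_simps)
    with True show ?thesis
      by (simp add: gamma_density_def abs_powr_def scaleR_conv_of_real Gamma_complex_of_real exp_minus
          inverse_eq_divide mult.assoc[symmetric] mult.commute[of "inverse _"])
  qed (simp add: gamma_density_def)
  have meas: "(\<lambda>t. indicator {0<..} t *\<^sub>R ?f t) \<in> borel_measurable lborel"
  proof -
    have "(\<lambda>t. indicator {0<..} t *\<^sub>R ?f t) = (\<lambda>t. indicator {0<..} t *\<^sub>R (abs_powr (?z - 1) t / of_real (exp t)))"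
      by (auto simp: abs_powr_def indicator_def fun_eq_iff)
    also have "\<dots> \<in> borel_measurable lborel" by measurable
    finally show ?thesis .
  qed
  \<comment> \<open>Euler's integral is taken over the completed measure; Borel measurability of the
    integrand transfers it to \<open>lborel\<close>.\<close>
  have abs: "set_integrable lebesgue {0<..} ?f"
    by (rule absolutely_integrable_Gamma_integral'[OF z])
  then have int: "integrable lborel (\<lambda>t. indicator {0<..} t *\<^sub>R ?f t)"
    using meas unfolding set_integrable_def by (simp add: integrable_completion)
  have "(\<integral>t. indicator {0<..} t *\<^sub>R ?f t \<partial>lborel) = integral {0<..} ?f"
    using set_lebesgue_integral_eq_integral(2)[OF abs] meas
    by (simp add: set_lebesgue_integral_def integral_completion)
  also have "\<dots> = Gamma ?z" using Gamma_integral_complex'[OF z] by (rule integral_unique)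
  finally have val: "(\<integral>t. indicator {0<..} t *\<^sub>R ?f t \<partial>lborel) = Gamma ?z" .
  show "integrable lborel (\<lambda>t. gamma_density a t *\<^sub>R abs_powr s t)"
    unfolding eq using int by simp
  show "(\<integral>t. gamma_density a t *\<^sub>R abs_powr s t \<partial>lborel) = Gamma ?z / Gamma (of_real a)"
    unfolding eq using val by simp
qed

lemma gamma_variable_measurable: "gamma_variable M a X \<Longrightarrow> X \<in> borel_measurable M"
  by (simp add: gamma_variable_def distributed_def)

lemma gamma_density_measurable: "gamma_density a \<in> borel_measurable borel"
  unfolding gamma_density_def by measurable

lemma gamma_variable_moment:
  assumes X: "gamma_variable M a X" and a: "a > 0" and s: "Re s > - a"
  shows "integrable M (\<lambda>\<omega>. abs_powr s (X \<omega>))"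
    and "(\<integral>\<omega>. abs_powr s (X \<omega>) \<partial>M) = Gamma (of_real a + s) / Gamma (of_real a)"
proof -
  note [measurable] = gamma_variable_measurable[OF X] gamma_density_measurable
  have D: "distr M lborel X = density lborel (\<lambda>t. ennreal (gamma_density a t))"
    using X by (simp add: gamma_variable_def distributed_def)
  have "integrable (density lborel (\<lambda>t. ennreal (gamma_density a t))) (abs_powr s)"
    using gamma_density_moment(1)[OF a s] gamma_density_nonneg[OF a] by (subst integrable_density) auto
  then show "integrable M (\<lambda>\<omega>. abs_powr s (X \<omega>))"
    unfolding D[symmetric] by (subst (asm) integrable_distr_eq) auto
  have "(\<integral>\<omega>. abs_powr s (X \<omega>) \<partial>M) = (\<integral>t. abs_powr s t \<partial>density lborel (\<lambda>t. ennreal (gamma_density a t)))"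
    unfolding D[symmetric] by (subst integral_distr) auto
  also have "\<dots> = Gamma (of_real a + s) / Gamma (of_real a)"
    using gamma_density_moment(2)[OF a s] gamma_density_nonneg[OF a] by (subst integral_density) auto
  finally show "(\<integral>\<omega>. abs_powr s (X \<omega>) \<partial>M) = Gamma (of_real a + s) / Gamma (of_real a)" .
qed

lemma gamma_variable_pos:
  assumes X: "gamma_variable M a X"
  shows "AE \<omega> in M. X \<omega> > 0"
proof -
  note [measurable] = gamma_variable_measurable[OF X] gamma_density_measurable
  have D: "distr M lborel X = density lborel (\<lambda>t. ennreal (gamma_density a t))"
    using X by (simp add: gamma_variable_def distributed_def)
  have "AE t in density lborel (\<lambda>t. ennreal (gamma_density a t)). t > 0"
    by (subst AE_density) (auto simp: gamma_density_def)
  then have "AE t in distr M lborel X. t > 0" by (simp only: D)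
  then show ?thesis by (rule AE_distrD[rotated]) simp
qed

text \<open>Moments of imaginary order are the characteristic functions of \<open>ln P\<close> and
  \<open>ln Q\<close>, so Levy's uniqueness theorem identifies the laws of the logarithms and
  \<open>exp\<close> leads back. Positivity almost everywhere ensures that \<open>exp\<close>
  inverts \<open>ln\<close>.\<close>

lemma distr_eqI_log_char:
  fixes P :: "'a \<Rightarrow> real" and Q :: "'b \<Rightarrow> real"
  assumes L: "prob_space L" and M: "prob_space M"
    and [measurable]: "P \<in> borel_measurable L" "Q \<in> borel_measurable M"
    and pos: "AE \<omega> in L. P \<omega> > 0" "AE \<omega> in M. Q \<omega> > 0"
    and char: "\<And>u::real. (\<integral>\<omega>. abs_powr (\<i> * of_real u) (P \<omega>) \<partial>L) = (\<integral>\<omega>. abs_powr (\<i> * of_real u) (Q \<omega>) \<partial>M)"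
  shows "distr L borel P = distr M borel Q"
proof -
  have rd: "real_distribution (distr L borel (\<lambda>\<omega>. ln (P \<omega>)))" "real_distribution (distr M borel (\<lambda>\<omega>. ln (Q \<omega>)))"
    using L M by (auto intro!: prob_space.real_distribution_distr)
  have c: "char (distr N borel (\<lambda>\<omega>. ln (R \<omega>))) u = (\<integral>\<omega>. abs_powr (\<i> * of_real u) (R \<omega>) \<partial>N)"
    if [measurable]: "R \<in> borel_measurable N" and R: "AE \<omega> in N. R \<omega> > 0" for N :: "'c measure" and R u
    unfolding char_def using R
    by (subst integral_distr) (auto intro!: integral_cong_AE elim!: eventually_mono simp: abs_powr_imaginary)
  have "char (distr L borel (\<lambda>\<omega>. ln (P \<omega>))) = char (distr M borel (\<lambda>\<omega>. ln (Q \<omega>)))"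
    using pos by (simp add: c char fun_eq_iff)
  then have eq: "distr L borel (\<lambda>\<omega>. ln (P \<omega>)) = distr M borel (\<lambda>\<omega>. ln (Q \<omega>))"
    by (rule Levy_uniqueness[OF rd])
  have e: "distr N borel R = distr (distr N borel (\<lambda>\<omega>. ln (R \<omega>))) borel exp"
    if [measurable]: "R \<in> borel_measurable N" and R: "AE \<omega> in N. R \<omega> > 0" for N :: "'c measure" and R :: "'c \<Rightarrow> real"
    using R by (subst distr_distr) (auto intro!: distr_cong_AE elim!: eventually_mono simp: comp_def)
  show ?thesis using e[of P L] e[of Q M] pos eq by simp
qed

section \<open>Haar measure on the full unitary group\<close>

lemma conj_transpose_mult: "conj_transpose (U ** A) = conj_transpose A ** conj_transpose U"
  by (simp add: vec_eq_iff conj_transpose_def matrix_matrix_mult_def mult.commute)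

lemma unitary_group_mult:
  assumes U: "U \<in> unitary_group" and A: "A \<in> unitary_group"
  shows "U ** A \<in> unitary_group"
proof -
  have "conj_transpose (U ** A) ** (U ** A) = conj_transpose A ** (conj_transpose U ** U) ** A"
    by (simp add: conj_transpose_mult matrix_mul_assoc)
  moreover have "(U ** A) ** conj_transpose (U ** A) = U ** (A ** conj_transpose A) ** conj_transpose U"
    by (simp add: conj_transpose_mult matrix_mul_assoc)
  ultimately show ?thesis using U A by (simp add: unitary_group_def)
qed

text \<open>Haar measure is given on the trace of the Borel sets on the group. The inclusion map
  transports it, together with its invariance, to the whole matrix space on which
  \<open>block_invariant\<close> is formulated.\<close>

lemma haar_distributed_block_invariant:
  fixes \<Lambda> :: "'a \<Rightarrow> complex ^ 'n ^ 'n"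
  assumes M: "prob_space M" and \<Lambda>: "haar_distributed M \<Lambda>"
  shows "\<Lambda> \<in> borel_measurable M" and "block_invariant (distr M borel \<Lambda>) UNIV"
proof -
  let ?\<nu> = "distr M unitary_borel \<Lambda>"
  have meas: "\<Lambda> \<in> measurable M unitary_borel" and inv: "\<And>U. U \<in> unitary_group \<Longrightarrow> distr ?\<nu> ?\<nu> (\<lambda>A. U ** A) = ?\<nu>"
    using \<Lambda> by (auto simp: haar_distributed_def haar_probability_def)
  then show \<Lambda>_borel: "\<Lambda> \<in> borel_measurable M"
    by (simp add: measurable_restrict_space2_iff)
  have unitary: "\<Lambda> \<omega> \<in> unitary_group" if "\<omega> \<in> space M" for \<omega>
    using meas that by (auto simp: measurable_restrict_space2_iff)
  interpret prob_space "distr M borel \<Lambda>" by (rule prob_space.prob_space_distr[OF M \<Lambda>_borel])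
  have id: "(\<lambda>A. A) \<in> measurable ?\<nu> borel"
    by (simp add: measurable_restrict_space1)
  show "block_invariant (distr M borel \<Lambda>) UNIV"
  proof
    show "AE A in distr M borel \<Lambda>. A \<in> block_unitary UNIV"
      using borel_closed[OF closed_block_unitary, of UNIV] unitary \<Lambda>_borel by (subst AE_distr_iff) auto
    show "distr (distr M borel \<Lambda>) borel ((**) U) = distr M borel \<Lambda>" if "U \<in> block_unitary UNIV" for U
    proof -
      from that have U: "U \<in> unitary_group" by simp
      have mult: "(\<lambda>A. U ** A) \<in> measurable ?\<nu> ?\<nu>"
        using unitary_group_mult[OF U]
        by (simp add: measurable_restrict_space2_iff measurable_restrict_space1 space_restrict_space)
      have lift: "distr M borel \<Lambda> = distr ?\<nu> borel (\<lambda>A. A)"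
        using meas id by (subst distr_distr) (auto simp: comp_def)
      have "distr (distr M borel \<Lambda>) borel ((**) U) = distr ?\<nu> borel (\<lambda>A. U ** A)"
        unfolding lift using id by (subst distr_distr) (auto simp: comp_def)
      also have "\<dots> = distr (distr ?\<nu> ?\<nu> (\<lambda>A. U ** A)) borel (\<lambda>A. A)"
        using id mult by (subst distr_distr) (auto simp: comp_def)
      also have "\<dots> = distr M borel \<Lambda>" by (simp only: inv[OF U] lift)
      finally show ?thesis .
    qed
  qed simp
qed

lemma borel_measurable_Z [measurable]: "(Z :: complex ^ 'n ^ 'n \<Rightarrow> complex) \<in> borel_measurable borel"
  using borel_measurable_block_det[of "UNIV :: 'n set"] by (simp add: block_det_UNIV[abs_def])

text \<open>The case \<open>S = UNIV\<close> of \<open>block_det_moment\<close>, with total mass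
  1.\<close>

theorem haar_Z_moment:
  fixes \<Lambda> :: "'a \<Rightarrow> complex ^ 'n ^ 'n"
  assumes M: "prob_space M" and \<Lambda>: "haar_distributed M \<Lambda>" and t: "Re t > - 1"
  shows "integrable M (\<lambda>\<omega>. complex_of_real (cmod (Z (\<Lambda> \<omega>))) powr t)"
    and "(\<integral>\<omega>. complex_of_real (cmod (Z (\<Lambda> \<omega>))) powr t \<partial>M) =
      (\<Prod>j = 1..CARD('n). Gamma (of_nat j) * Gamma (of_nat j + t) / (Gamma (of_nat j + t / 2))\<^sup>2)"
proof -
  note [measurable] = haar_distributed_block_invariant(1)[OF M \<Lambda>]
  interpret prob_space "distr M borel \<Lambda>" by (rule prob_space.prob_space_distr[OF M]) simp
  note moment = block_det_moment[OF t haar_distributed_block_invariant(2)[OF M \<Lambda>], unfolded block_det_UNIV]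
  show "integrable M (\<lambda>\<omega>. complex_of_real (cmod (Z (\<Lambda> \<omega>))) powr t)"
    using moment[THEN conjunct1] by (subst (asm) integrable_distr_eq) auto
  show "(\<integral>\<omega>. complex_of_real (cmod (Z (\<Lambda> \<omega>))) powr t \<partial>M) =
      (\<Prod>j = 1..CARD('n). Gamma (of_nat j) * Gamma (of_nat j + t) / (Gamma (of_nat j + t / 2))\<^sup>2)"
    using moment[THEN conjunct2] prob_space by (subst (asm) integral_distr) auto
qed

lemma haar_Z_nonzero:
  fixes \<Lambda> :: "'a \<Rightarrow> complex ^ 'n ^ 'n"
  assumes M: "prob_space M" and \<Lambda>: "haar_distributed M \<Lambda>"
  shows "AE \<omega> in M. Z (\<Lambda> \<omega>) \<noteq> 0"
proof -
  interpret prob_space M by fact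
  note [measurable] = haar_distributed_block_invariant(1)[OF M \<Lambda>]
  \<comment> \<open>At \<open>t = 0\<close> the integrand is the indicator of \<open>Z \<noteq> 0\<close>, because \<open>0 powr 0 = 0\<close>.\<close>
  have "complex_of_real (cmod (Z (\<Lambda> \<omega>))) powr 0 = of_real (indicator {\<omega> \<in> space M. Z (\<Lambda> \<omega>) \<noteq> 0} \<omega>)"
    if "\<omega> \<in> space M" for \<omega>
    using that by (simp add: indicator_def)
  then have "complex_of_real (prob {\<omega> \<in> space M. Z (\<Lambda> \<omega>) \<noteq> 0}) = (\<integral>\<omega>. complex_of_real (cmod (Z (\<Lambda> \<omega>))) powr 0 \<partial>M)"
    by (simp cong: Bochner_Integration.integral_cong)
  also have "\<dots> = (\<Prod>j = 1..CARD('n). Gamma (of_nat j) * Gamma (of_nat j + 0) / (Gamma (of_nat j + 0 / 2))\<^sup>2)"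
    by (rule haar_Z_moment(2)[OF M \<Lambda>]) simp
  also have "\<dots> = 1"
    by (intro prod.neutral) (auto simp: power2_eq_square Gamma_eq_zero_iff of_nat_in_nonpos_Ints_iff)
  finally have "prob {\<omega> \<in> space M. Z (\<Lambda> \<omega>) \<noteq> 0} = 1" by simp
  then show ?thesis by (simp add: prob_Collect_eq_1)
qed

lemma gamma_product_moment:
  assumes L: "prob_space L" and \<delta>: "\<And>j. j \<in> {1..n} \<Longrightarrow> gamma_variable L (real j) (\<delta> j)"
    and indep: "prob_space.indep_vars L (\<lambda>_. borel) \<delta> {1..n}" and s: "Re s > - 1"
  shows "(\<integral>\<omega>. abs_powr s (\<Prod>j = 1..n. \<delta> j \<omega>) \<partial>L) = (\<Prod>j = 1..n. Gamma (of_nat j + s) / Gamma (of_nat j))"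
proof -
  interpret prob_space L by fact
  have ind: "indep_vars (\<lambda>_. borel) (\<lambda>j \<omega>. abs_powr s (\<delta> j \<omega>)) {1..n}"
    by (rule indep_vars_compose2[OF indep]) simp
  have s': "Re s > - real j" if "j \<in> {1..n}" for j using s that by simp
  have "(\<integral>\<omega>. abs_powr s (\<Prod>j = 1..n. \<delta> j \<omega>) \<partial>L) = (\<Prod>j = 1..n. \<integral>\<omega>. abs_powr s (\<delta> j \<omega>) \<partial>L)"
    unfolding abs_powr_prod[OF finite_atLeastAtMost]
    by (rule indep_vars_lebesgue_integral[OF _ ind]) (auto intro!: gamma_variable_moment(1)[OF \<delta> _ s'])
  also have "\<dots> = (\<Prod>j = 1..n. Gamma (of_nat j + s) / Gamma (of_nat j))"
    using gamma_variable_moment(2)[OF \<delta> _ s'] by (intro prod.cong refl) simp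
  finally show ?thesis .
qed

text \<open>Independence factors the expectation. The square roots turn order \<open>s\<close> into
  \<open>s / 2\<close> for each gamma variable, and the two families contribute equal products,
  hence the square.\<close>

lemma joint_product_moment:
  fixes \<Lambda> :: "'a \<Rightarrow> complex ^ 'n ^ 'n"
  assumes M: "prob_space M" and \<Lambda>: "haar_distributed M \<Lambda>"
    and \<gamma>: "\<And>j. j \<in> {1..n} \<Longrightarrow> gamma_variable M (real j) (\<gamma> j)"
    and \<gamma>': "\<And>j. j \<in> {1..n} \<Longrightarrow> gamma_variable M (real j) (\<gamma>' j)"
    and indep: "jointly_independent M \<Lambda> \<gamma> \<gamma>' {1..n}" and s: "Re s > - 1"
  shows "(\<integral>\<omega>. abs_powr s (cmod (Z (\<Lambda> \<omega>)) * (\<Prod>j = 1..n. sqrt (\<gamma> j \<omega> * \<gamma>' j \<omega>))) \<partial>M)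
    = (\<integral>\<omega>. abs_powr s (cmod (Z (\<Lambda> \<omega>))) \<partial>M) * (\<Prod>j = 1..n. Gamma (of_nat j + s / 2) / Gamma (of_nat j))\<^sup>2"
proof -
  interpret prob_space M by fact
  note [measurable] = haar_distributed_block_invariant(1)[OF M \<Lambda>]
  have unitary: "\<Lambda> \<in> measurable M unitary_borel" using \<Lambda> by (simp add: haar_distributed_def)
  \<comment> \<open>Collects the factors, now all complex-valued, in one family over
    \<open>rv_index\<close>, so that \<open>indep_vars\<close> applies.\<close>
  define Y where "Y i = (case i of Mat \<Rightarrow> \<lambda>\<omega>. abs_powr s (cmod (Z (\<Lambda> \<omega>)))
      | Gam j \<Rightarrow> \<lambda>\<omega>. abs_powr (s / 2) (\<gamma> j \<omega>) | Gam' j \<Rightarrow> \<lambda>\<omega>. abs_powr (s / 2) (\<gamma>' j \<omega>))" for i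
  let ?J = "{1..n}"
  let ?I = "{Mat} \<union> Gam ` ?J \<union> Gam' ` ?J"
  let ?F = "\<lambda>i. case i of Mat \<Rightarrow> sets (vimage_algebra (space M) \<Lambda> unitary_borel)
            | Gam j \<Rightarrow> sets (vimage_algebra (space M) (\<gamma> j) borel)
            | Gam' j \<Rightarrow> sets (vimage_algebra (space M) (\<gamma>' j) borel)"
  have Y_meas: "Y i \<in> borel_measurable M" if "i \<in> ?I" for i
    using that gamma_variable_measurable[OF \<gamma>] gamma_variable_measurable[OF \<gamma>'] by (auto simp: Y_def)
  \<comment> \<open>Preimages under \<open>Y i\<close> lie in the sigma-algebra generated by the
    variable behind it, so independence is inherited.\<close>
  have "indep_sets (\<lambda>i. {Y i -` A \<inter> space M |A. A \<in> sets borel}) ?I"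
  proof (rule indep_sets_mono_sets)
    show "indep_sets ?F ?I" using indep by (simp add: jointly_independent_def)
    fix i assume i: "i \<in> ?I"
    show "{Y i -` A \<inter> space M |A. A \<in> sets borel} \<subseteq> ?F i"
    proof (cases i)
      case Mat
      have "(\<lambda>\<omega>. abs_powr s (cmod (Z (\<Lambda> \<omega>)))) \<in> borel_measurable (vimage_algebra (space M) \<Lambda> unitary_borel)"
        by (rule measurable_compose[OF measurable_vimage_algebra1])
          (use measurable_space[OF unitary] in \<open>auto intro!: measurable_restrict_space1\<close>)
      from measurable_sets[OF this] show ?thesis by (auto simp: Mat Y_def)
    next
      case (Gam j)
      have "(\<lambda>\<omega>. abs_powr (s / 2) (\<gamma> j \<omega>)) \<in> borel_measurable (vimage_algebra (space M) (\<gamma> j) borel)"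
        by (rule measurable_compose[OF measurable_vimage_algebra1]) auto
      from measurable_sets[OF this] show ?thesis by (auto simp: Gam Y_def)
    next
      case (Gam' j)
      have "(\<lambda>\<omega>. abs_powr (s / 2) (\<gamma>' j \<omega>)) \<in> borel_measurable (vimage_algebra (space M) (\<gamma>' j) borel)"
        by (rule measurable_compose[OF measurable_vimage_algebra1]) auto
      from measurable_sets[OF this] show ?thesis by (auto simp: Gam' Y_def)
    qed
  qed
  with Y_meas have ind: "indep_vars (\<lambda>_. borel) Y ?I"
    by (simp add: indep_vars_def2)
  have half: "Re (s / 2) > - real j" if "j \<in> ?J" for j using s that by simp
  have Y_int: "integrable M (Y i)" if "i \<in> ?I" for i
    using that gamma_variable_moment(1)[OF \<gamma> _ half] gamma_variable_moment(1)[OF \<gamma>' _ half] haar_Z_moment(1)[OF M \<Lambda> s]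
    by (auto simp: Y_def abs_powr_cmod)
  have prod_I: "(\<Prod>i\<in>?I. f i) = f Mat * ((\<Prod>j\<in>?J. f (Gam j)) * (\<Prod>j\<in>?J. f (Gam' j)))" for f :: "rv_index \<Rightarrow> complex"
  proof -
    have "(\<Prod>i\<in>?I. f i) = f Mat * (\<Prod>i\<in>Gam ` ?J \<union> Gam' ` ?J. f i)"
      by (subst Un_assoc, subst prod.union_disjoint) auto
    also have "(\<Prod>i\<in>Gam ` ?J \<union> Gam' ` ?J. f i) = (\<Prod>i\<in>Gam ` ?J. f i) * (\<Prod>i\<in>Gam' ` ?J. f i)"
      by (rule prod.union_disjoint) auto
    also have "(\<Prod>i\<in>Gam ` ?J. f i) = (\<Prod>j\<in>?J. f (Gam j))"
      by (subst prod.reindex) (auto simp: inj_on_def)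
    also have "(\<Prod>i\<in>Gam' ` ?J. f i) = (\<Prod>j\<in>?J. f (Gam' j))"
      by (subst prod.reindex) (auto simp: inj_on_def)
    finally show ?thesis .
  qed
  have "abs_powr s (cmod (Z (\<Lambda> \<omega>)) * (\<Prod>j = 1..n. sqrt (\<gamma> j \<omega> * \<gamma>' j \<omega>))) = (\<Prod>i\<in>?I. Y i \<omega>)" for \<omega>
    unfolding prod_I
    by (simp add: Y_def abs_powr_mult abs_powr_prod abs_powr_sqrt prod.distrib)
  then have "(\<integral>\<omega>. abs_powr s (cmod (Z (\<Lambda> \<omega>)) * (\<Prod>j = 1..n. sqrt (\<gamma> j \<omega> * \<gamma>' j \<omega>))) \<partial>M)
      = (\<integral>\<omega>. (\<Prod>i\<in>?I. Y i \<omega>) \<partial>M)" by (simp only:)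
  also have "\<dots> = (\<Prod>i\<in>?I. \<integral>\<omega>. Y i \<omega> \<partial>M)"
    by (rule indep_vars_lebesgue_integral[OF _ ind Y_int]) auto
  also have "\<dots> = (\<integral>\<omega>. abs_powr s (cmod (Z (\<Lambda> \<omega>))) \<partial>M) *
      ((\<Prod>j\<in>?J. \<integral>\<omega>. abs_powr (s / 2) (\<gamma> j \<omega>) \<partial>M) * (\<Prod>j\<in>?J. \<integral>\<omega>. abs_powr (s / 2) (\<gamma>' j \<omega>) \<partial>M))"
    unfolding prod_I by (simp add: Y_def)
  also have "(\<Prod>j\<in>?J. \<integral>\<omega>. abs_powr (s / 2) (\<gamma> j \<omega>) \<partial>M) = (\<Prod>j = 1..n. Gamma (of_nat j + s / 2) / Gamma (of_nat j))"
    using gamma_variable_moment(2)[OF \<gamma> _ half] by (intro prod.cong refl) simp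
  also have "(\<Prod>j\<in>?J. \<integral>\<omega>. abs_powr (s / 2) (\<gamma>' j \<omega>) \<partial>M) = (\<Prod>j = 1..n. Gamma (of_nat j + s / 2) / Gamma (of_nat j))"
    using gamma_variable_moment(2)[OF \<gamma>' _ half] by (intro prod.cong refl) simp
  finally show ?thesis by (simp add: power2_eq_square)
qed

theorem theorem1p3:
  fixes M :: "'a measure" and \<Lambda> :: "'a \<Rightarrow> complex ^ 'n ^ 'n"
  assumes "prob_space M" and "haar_distributed M \<Lambda>"
  shows
    "(\<forall>t::complex. Re t > - 1 \<longrightarrow>
        integrable M (\<lambda>\<omega>. complex_of_real (cmod (Z (\<Lambda> \<omega>))) powr t) \<and>
        prob_space.expectation M (\<lambda>\<omega>. complex_of_real (cmod (Z (\<Lambda> \<omega>))) powr t) =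
          (\<Prod>j = 1..CARD('n).
             Gamma (of_nat j) * Gamma (of_nat j + t) / (Gamma (of_nat j + t / 2))\<^sup>2))
     \<and>
     (\<forall>(L :: 'b measure) (\<delta> :: nat \<Rightarrow> 'b \<Rightarrow> real) (\<gamma> :: nat \<Rightarrow> 'a \<Rightarrow> real) (\<gamma>' :: nat \<Rightarrow> 'a \<Rightarrow> real).
        prob_space L \<longrightarrow>
        (\<forall>j\<in>{1..CARD('n)}. gamma_variable L (real j) (\<delta> j)) \<longrightarrow>
        prob_space.indep_vars L (\<lambda>_. borel) \<delta> {1..CARD('n)} \<longrightarrow>
        (\<forall>j\<in>{1..CARD('n)}. gamma_variable M (real j) (\<gamma> j) \<and> gamma_variable M (real j) (\<gamma>' j)) \<longrightarrow>
        jointly_independent M \<Lambda> \<gamma> \<gamma>' {1..CARD('n)} \<longrightarrow>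
        distr L borel (\<lambda>\<omega>. \<Prod>j = 1..CARD('n). \<delta> j \<omega>) =
        distr M borel (\<lambda>\<omega>. cmod (Z (\<Lambda> \<omega>)) * (\<Prod>j = 1..CARD('n). sqrt (\<gamma> j \<omega> * \<gamma>' j \<omega>))))"
proof (intro conjI allI impI)
  fix t :: complex assume t: "Re t > - 1"
  show "integrable M (\<lambda>\<omega>. complex_of_real (cmod (Z (\<Lambda> \<omega>))) powr t)"
    by (rule haar_Z_moment(1)[OF assms t])
  show "prob_space.expectation M (\<lambda>\<omega>. complex_of_real (cmod (Z (\<Lambda> \<omega>))) powr t) =
      (\<Prod>j = 1..CARD('n). Gamma (of_nat j) * Gamma (of_nat j + t) / (Gamma (of_nat j + t / 2))\<^sup>2)"
    by (rule haar_Z_moment(2)[OF assms t])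
next
  fix L :: "'b measure" and \<delta> :: "nat \<Rightarrow> 'b \<Rightarrow> real" and \<gamma> \<gamma>' :: "nat \<Rightarrow> 'a \<Rightarrow> real"
  assume L: "prob_space L"
    and \<delta>: "\<forall>j\<in>{1..CARD('n)}. gamma_variable L (real j) (\<delta> j)"
    and indep_\<delta>: "prob_space.indep_vars L (\<lambda>_. borel) \<delta> {1..CARD('n)}"
    and \<gamma>\<gamma>': "\<forall>j\<in>{1..CARD('n)}. gamma_variable M (real j) (\<gamma> j) \<and> gamma_variable M (real j) (\<gamma>' j)"
    and indep: "jointly_independent M \<Lambda> \<gamma> \<gamma>' {1..CARD('n)}"
  let ?P = "\<lambda>\<omega>. \<Prod>j = 1..CARD('n). \<delta> j \<omega>"
  let ?Q = "\<lambda>\<omega>. cmod (Z (\<Lambda> \<omega>)) * (\<Prod>j = 1..CARD('n). sqrt (\<gamma> j \<omega> * \<gamma>' j \<omega>))"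
  note [measurable] = haar_distributed_block_invariant(1)[OF assms]
  have meas: "\<delta> j \<in> borel_measurable L" "\<gamma> j \<in> borel_measurable M" "\<gamma>' j \<in> borel_measurable M"
    if "j \<in> {1..CARD('n)}" for j
    using \<delta> \<gamma>\<gamma>' that by (auto intro: gamma_variable_measurable)
  show "distr L borel ?P = distr M borel ?Q"
  proof (rule distr_eqI_log_char[OF L assms(1)])
    show "?P \<in> borel_measurable L" using meas by (intro borel_measurable_prod) auto
    show "?Q \<in> borel_measurable M" using meas
      by (intro borel_measurable_times borel_measurable_prod borel_measurable_sqrt) auto
    have "AE \<omega> in L. \<forall>j\<in>{1..CARD('n)}. \<delta> j \<omega> > 0"
      using \<delta> by (auto intro!: AE_finite_allI gamma_variable_pos)
    then show "AE \<omega> in L. ?P \<omega> > 0" by eventually_elim (auto intro!: prod_pos)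
    have "AE \<omega> in M. \<forall>j\<in>{1..CARD('n)}. \<gamma> j \<omega> > 0" "AE \<omega> in M. \<forall>j\<in>{1..CARD('n)}. \<gamma>' j \<omega> > 0"
      using \<gamma>\<gamma>' by (auto intro!: AE_finite_allI gamma_variable_pos)
    then show "AE \<omega> in M. ?Q \<omega> > 0"
      using haar_Z_nonzero[OF assms] by eventually_elim (auto intro!: mult_pos_pos prod_pos)
  next
    fix u :: real
    define s where "s = \<i> * complex_of_real u"
    have s: "Re s > - 1" by (simp add: s_def)
    have nz: "Gamma (complex_of_nat j) \<noteq> 0" "Gamma (of_nat j + s / 2) \<noteq> 0" if "j \<in> {1..CARD('n)}" for j
    proof -
      have "of_nat j \<notin> (\<int>\<^sub>\<le>\<^sub>0 :: complex set)" "of_nat j + s / 2 \<notin> \<int>\<^sub>\<le>\<^sub>0"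
        using that by (auto intro!: Re_gt_imp_not_nonpos_Ints simp: s_def)
      then show "Gamma (complex_of_nat j) \<noteq> 0" "Gamma (of_nat j + s / 2) \<noteq> 0"
        by (simp_all add: Gamma_eq_zero_iff)
    qed
    have "(\<integral>\<omega>. abs_powr s (?Q \<omega>) \<partial>M) =
        (\<Prod>j = 1..CARD('n). Gamma (of_nat j) * Gamma (of_nat j + s) / (Gamma (of_nat j + s / 2))\<^sup>2) *
        (\<Prod>j = 1..CARD('n). Gamma (of_nat j + s / 2) / Gamma (of_nat j))\<^sup>2"
      using joint_product_moment[OF assms _ _ indep s] \<gamma>\<gamma>' haar_Z_moment(2)[OF assms s]
      by (simp add: abs_powr_cmod)
    \<comment> \<open>The two factors \<open>Gamma (j + s / 2)\<close> supplied by
      \<open>\<gamma> j\<close> and \<open>\<gamma>' j\<close> cancel the denominator in the moment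
      of \<open>Z\<close>; what remains is the moment of the product of the
      \<open>\<delta> j\<close>.\<close>
    also have "\<dots> = (\<Prod>j = 1..CARD('n). Gamma (of_nat j + s) / Gamma (of_nat j))"
      unfolding prod_power_distrib prod.distrib[symmetric] using nz
      by (intro prod.cong refl) (simp add: power2_eq_square divide_simps)
    also have "\<dots> = (\<integral>\<omega>. abs_powr s (?P \<omega>) \<partial>L)"
      using gamma_product_moment[OF L _ indep_\<delta> s] \<delta> by simp
    finally show "(\<integral>\<omega>. abs_powr (\<i> * of_real u) (?P \<omega>) \<partial>L) = (\<integral>\<omega>. abs_powr (\<i> * of_real u) (?Q \<omega>) \<partial>M)"
      by (simp add: s_def)
  qed
qed

end
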